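(* Let $\Sigma$ be the full solenoid over $S^1$, i.e. $\Sigma=\Sigma_{\mathcal{P}}$ with $\mathcal{P}$ the set of all primes. Then the Hausdorff dimension of any cylinder absolute winning subset of $\Sigma$ is infinite.
   Context: Setting. $\mathcal{P}=\{p_1<p_2<\cdots\}$ is the set of all primes. $X_{\mathcal{P}}=\mathbb{R}\times\prod'_{p\in\mathcal{P}}\mathbb{Q}_p$ is the restricted product: elements are $\mathbf{x}=(x_0,x_1,x_2,\dots)$ with $x_0\in\mathbb{R}$, $x_i\in\mathbb{Q}_{p_i}$, and $x_i\in\mathbb{Z}_{p_i}$ for all but finitely many $i$. The metric is $d(\mathbf{x},\mathbf{z})=\max\{|x_0-z_0|,\ \sup_{i\ge1}p_i^{-1}|x_i-z_i|_{p_i}\}$, with $|\cdot|_p$ the usual $p$-adic absolute value ($|p|_p=1/p$). $\overline{B}(\mathbf{x},r)=\{\mathbf{z}: d(\mathbf{x},\mathbf{z})\le r\}$ is the closed ball of radius $r>0$. With $R=\mathbb{Z}[\{p^{-1}:p\in\mathcal{P}\}]=\mathbb{Q}$ embedded diagonally by $\Delta$ (as a uniform lattice), $\Sigma_{\mathcal{P}}=X_{\mathcal{P}}/\Delta(R)$ carries the quotient metric, and $\Pi:X_{\mathcal{P}}\to\Sigma_{\mathcal{P}}$ is the quotient map. Cylinders. For $\mathbf{x}\in X_{\mathcal{P}}$, $\varepsilon>0$, the open cylinder $C(\mathbf{x},\varepsilon,i)$ with constraining coordinate $i$ is $\{\mathbf{z}\in X_{\mathcal{P}}:|z_0-x_0|<\varepsilon\}$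 if $i=0$ and $\{\mathbf{z}\in X_{\mathcal{P}}:|z_i-x_i|_{p_i}<p_i\varepsilon\}$ if $i>0$. Its radius is $\varepsilon$ if $i=0$, and the infimum of all $\varepsilon'>0$ with $C(\mathbf{x},\varepsilon',i)=C(\mathbf{x},\varepsilon,i)$ if $i>0$. Game. Let $F\subset X_{\mathcal{P}}$ and $0<\beta<1$. In the cylinder $\beta$-absolute game Bob first chooses a closed ball $B_0$. For $j\ge1$, given $B_{j-1}$, Alice chooses an open cylinder $C_j$ of radius at most $\beta\cdot\mathrm{radius}(B_{j-1})$, and then Bob chooses a closed ball $B_j\subset B_{j-1}\setminus C_j$ with $\mathrm{radius}(B_j)\ge\beta\cdot\mathrm{radius}(B_{j-1})$. If at some finite stage Bob has no legal choice, Bob wins; otherwise Alice wins iff $\bigcap_j B_j\cap F\ne\emptyset$. $F$ is cylinder $\beta$-absolute winning if Alice has a winning strategy, and cylinder absolute winning (CAW) if there is $0<\beta_1\le1/3$ such that it is cylinder $\beta$-absolute winning for all $\beta\in(0,\beta_1)$. A subset $F\subset\Sigma_{\mathcal{P}}$ is called CAW if $\Pi^{-1}(F)$ is CAW in $X_{\mathcal{P}}$. *)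

theory Defs
  imports "HOL-Analysis.Analysis" "HOL-Algebra.QuotRing" "HOL-Computational_Algebra.Primes"
begin

section \<open>The field of p-adic numbers\<close>

definition rat_pval :: "nat \<Rightarrow> rat \<Rightarrow> int" where
  "rat_pval p q = int (multiplicity (int p) (fst (quotient_of q)))
                - int (multiplicity (int p) (snd (quotient_of q)))"

definition rat_pabs :: "nat \<Rightarrow> rat \<Rightarrow> real" where
  "rat_pabs p q = (if q = 0 then 0 else real p powi (- rat_pval p q))"

text \<open>\<open>\<rat>\<^sub>p\<close> is the completion of the rationals: Cauchy sequences modulo null sequences.\<close>

definition padic_cauchy :: "nat \<Rightarrow> (nat \<Rightarrow> rat) set" where
  "padic_cauchy p = {a. \<forall>e>0. \<exists>N. \<forall>m\<ge>N. \<forall>n\<ge>N. rat_pabs p (a m - a n) < e}"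

definition padic_null :: "nat \<Rightarrow> (nat \<Rightarrow> rat) set" where
  "padic_null p = {a \<in> padic_cauchy p. (\<lambda>n. rat_pabs p (a n)) \<longlonglongrightarrow> 0}"

definition padic_cauchy_ring :: "nat \<Rightarrow> (nat \<Rightarrow> rat) ring" where
  "padic_cauchy_ring p =
     \<lparr>carrier = padic_cauchy p, mult = (\<lambda>a b n. a n * b n), one = (\<lambda>_. 1),
      zero = (\<lambda>_. 0), add = (\<lambda>a b n. a n + b n)\<rparr>"

definition Qp :: "nat \<Rightarrow> (nat \<Rightarrow> rat) set ring" where
  "Qp p = padic_cauchy_ring p Quot padic_null p"

definition padic_of_rat :: "nat \<Rightarrow> rat \<Rightarrow> (nat \<Rightarrow> rat) set" where
  "padic_of_rat p q = padic_null p +>\<^bsub>padic_cauchy_ring p\<^esub> (\<lambda>_. q)"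

definition padic_abs :: "nat \<Rightarrow> (nat \<Rightarrow> rat) set \<Rightarrow> real" where
  "padic_abs p A = (THE r. \<forall>a\<in>A. (\<lambda>n. rat_pabs p (a n)) \<longlonglongrightarrow> r)"

definition Zp :: "nat \<Rightarrow> (nat \<Rightarrow> rat) set set" where
  "Zp p = {x \<in> carrier (Qp p). padic_abs p x \<le> 1}"


section \<open>The restricted product and the full solenoid\<close>

text \<open>
  The \<open>p\<close>-adic coordinates are indexed by the primes \<open>p\<close> themselves instead of by their position
  in the increasing enumeration of the primes; the real coordinate is the first component.
\<close>

type_synonym cover_point = "real \<times> (nat \<Rightarrow> (nat \<Rightarrow> rat) set)"

abbreviation primes :: "nat set" where
  "primes \<equiv> {p. prime p}"

definition cover_carrier :: "cover_point set" where
  "cover_carrier = {x. snd x \<in> (\<Pi>\<^sub>E p\<in>primes. carrier (Qp p)) \<and>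
                       finite {p\<in>primes. snd x p \<notin> Zp p}}"

text \<open>The additive group of the restricted product, written as a \<open>monoid\<close> record so that its
  group operation is \<open>mult\<close>.\<close>

definition cover_group :: "cover_point monoid" where
  "cover_group =
     \<lparr>carrier = cover_carrier,
      mult = (\<lambda>x z. (fst x + fst z, \<lambda>p\<in>primes. snd x p \<oplus>\<^bsub>Qp p\<^esub> snd z p)),
      one = (0, \<lambda>p\<in>primes. \<zero>\<^bsub>Qp p\<^esub>)\<rparr>"

definition cover_dist :: "cover_point \<Rightarrow> cover_point \<Rightarrow> real" where
  "cover_dist x z =
     (if x \<in> cover_carrier \<and> z \<in> cover_carrier
      then max \<bar>fst x - fst z\<bar>
               (SUP p\<in>primes. padic_abs p (snd x p \<ominus>\<^bsub>Qp p\<^esub> snd z p) / real p)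
      else 0)"

abbreviation cover_cball :: "cover_point \<Rightarrow> real \<Rightarrow> cover_point set" where
  "cover_cball \<equiv> Metric_space.mcball cover_carrier cover_dist"

definition diag_embed :: "rat \<Rightarrow> cover_point" where
  "diag_embed q = (of_rat q, \<lambda>p\<in>primes. padic_of_rat p q)"

text \<open>For the set of all primes the ring \<open>\<int>[1/p : p prime]\<close> is all of \<open>\<rat>\<close>.\<close>

definition solenoid :: "cover_point set monoid" where
  "solenoid = cover_group Mod range diag_embed"

definition solenoid_proj :: "cover_point \<Rightarrow> cover_point set" where
  "solenoid_proj x = range diag_embed #>\<^bsub>cover_group\<^esub> x"

text \<open>As \<^const>\<open>cover_dist\<close> is translation invariant, the quotient metric is the distance of the cosets
  as subsets of the cover.\<close>

definition solenoid_dist :: "cover_point set \<Rightarrow> cover_point set \<Rightarrow> real" where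
  "solenoid_dist A B =
     (if A \<in> carrier solenoid \<and> B \<in> carrier solenoid
      then Inf {cover_dist x z | x z. x \<in> A \<and> z \<in> B} else 0)"


section \<open>The cylinder absolute game\<close>

text \<open>The constraining coordinate \<open>i\<close> is \<open>0\<close> for the real coordinate and the prime \<open>p\<close> for the
  \<open>p\<close>-adic one. A cylinder is handled through its data \<open>(x, \<epsilon>, i)\<close>.\<close>

definition cylinder :: "cover_point \<Rightarrow> real \<Rightarrow> nat \<Rightarrow> cover_point set" where
  "cylinder x \<epsilon> i =
     (if i = 0 then {z \<in> cover_carrier. \<bar>fst z - fst x\<bar> < \<epsilon>}
      else {z \<in> cover_carrier. padic_abs i (snd z i \<ominus>\<^bsub>Qp i\<^esub> snd x i) < real i * \<epsilon>})"

definition cylinder_radius :: "cover_point \<Rightarrow> real \<Rightarrow> nat \<Rightarrow> real" where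
  "cylinder_radius x \<epsilon> i =
     (if i = 0 then \<epsilon> else Inf {\<epsilon>'. \<epsilon>' > 0 \<and> cylinder x \<epsilon>' i = cylinder x \<epsilon> i})"

text \<open>A closed ball is handled through its centre and radius. The radius is determined by the ball as
  a set, because of the real coordinate.\<close>

type_synonym cover_ball = "cover_point \<times> real"
type_synonym cover_cyl = "cover_point \<times> real \<times> nat"

definition is_ball :: "cover_ball \<Rightarrow> bool" where
  "is_ball B \<longleftrightarrow> fst B \<in> cover_carrier \<and> snd B > 0"

definition ball_set :: "cover_ball \<Rightarrow> cover_point set" where
  "ball_set B = cover_cball (fst B) (snd B)"

definition is_cylinder :: "cover_cyl \<Rightarrow> bool" where
  "is_cylinder = (\<lambda>(x, \<epsilon>, i). x \<in> cover_carrier \<and> \<epsilon> > 0 \<and> (i = 0 \<or> prime i))"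

definition cyl_set :: "cover_cyl \<Rightarrow> cover_point set" where
  "cyl_set = (\<lambda>(x, \<epsilon>, i). cylinder x \<epsilon> i)"

definition cyl_radius :: "cover_cyl \<Rightarrow> real" where
  "cyl_radius = (\<lambda>(x, \<epsilon>, i). cylinder_radius x \<epsilon> i)"

definition alice_legal :: "real \<Rightarrow> cover_ball \<Rightarrow> cover_cyl \<Rightarrow> bool" where
  "alice_legal \<beta> B C \<longleftrightarrow> is_cylinder C \<and> cyl_radius C \<le> \<beta> * snd B"

definition bob_legal :: "real \<Rightarrow> cover_ball \<Rightarrow> cover_cyl \<Rightarrow> cover_ball \<Rightarrow> bool" where
  "bob_legal \<beta> B C B' \<longleftrightarrow>
     is_ball B' \<and> ball_set B' \<subseteq> ball_set B - cyl_set C \<and> snd B' \<ge> \<beta> * snd B"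

text \<open>A strategy of Alice maps the nonempty list \<open>[B\<^sub>0, \<dots>, B\<^sub>n]\<close> of Bob's choices so far to her
  next cylinder. The lists below are the finite plays in which Alice follows \<open>S\<close>, ending
  with a choice of Bob.\<close>

type_synonym alice_strategy = "cover_ball list \<Rightarrow> cover_cyl"

inductive play :: "real \<Rightarrow> alice_strategy \<Rightarrow> cover_ball list \<Rightarrow> bool"
  for \<beta> :: real and S :: alice_strategy where
  start: "is_ball B \<Longrightarrow> play \<beta> S [B]"
| extend: "play \<beta> S Bs \<Longrightarrow> bob_legal \<beta> (last Bs) (S Bs) B \<Longrightarrow> play \<beta> S (Bs @ [B])"

definition winning_strategy :: "real \<Rightarrow> cover_point set \<Rightarrow> alice_strategy \<Rightarrow> bool" where
  "winning_strategy \<beta> F S \<longleftrightarrow>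
     (\<forall>Bs. play \<beta> S Bs \<longrightarrow>
        alice_legal \<beta> (last Bs) (S Bs) \<and> (\<exists>B. bob_legal \<beta> (last Bs) (S Bs) B)) \<and>
     (\<forall>B :: nat \<Rightarrow> cover_ball. (\<forall>n. play \<beta> S (map B [0..<Suc n])) \<longrightarrow>
        (\<Inter>n. ball_set (B n)) \<inter> F \<noteq> {})"

definition cylinder_absolute_winning_at :: "real \<Rightarrow> cover_point set \<Rightarrow> bool" where
  "cylinder_absolute_winning_at \<beta> F \<longleftrightarrow> (\<exists>S. winning_strategy \<beta> F S)"

definition CAW :: "cover_point set \<Rightarrow> bool" where
  "CAW F \<longleftrightarrow> F \<subseteq> cover_carrier \<and>
     (\<exists>\<beta>\<^sub>1. 0 < \<beta>\<^sub>1 \<and> \<beta>\<^sub>1 \<le> 1/3 \<and> (\<forall>\<beta>. 0 < \<beta> \<and> \<beta> < \<beta>\<^sub>1 \<longrightarrow> cylinder_absolute_winning_at \<beta> F))"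

definition solenoid_CAW :: "cover_point set set \<Rightarrow> bool" where
  "solenoid_CAW F \<longleftrightarrow> F \<subseteq> carrier solenoid \<and> CAW {x \<in> cover_carrier. solenoid_proj x \<in> F}"


section \<open>Hausdorff dimension\<close>

text \<open>Hausdorff measure and dimension of a subset \<open>E\<close> of the metric space \<open>(M, d)\<close>. Only exponents
  \<open>s > 0\<close> are used, which does not affect the infimum and avoids the convention for \<open>0\<^sup>0\<close>.\<close>

definition ediam :: "('a \<Rightarrow> 'a \<Rightarrow> real) \<Rightarrow> 'a set \<Rightarrow> ennreal" where
  "ediam d U = (SUP x\<in>U. SUP y\<in>U. ennreal (d x y))"

definition hausdorff_premeasure ::
    "'a set \<Rightarrow> ('a \<Rightarrow> 'a \<Rightarrow> real) \<Rightarrow> real \<Rightarrow> real \<Rightarrow> 'a set \<Rightarrow> ennreal" where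
  "hausdorff_premeasure M d s \<delta> E =
     (INF U \<in> {U :: nat \<Rightarrow> 'a set. (\<forall>n. U n \<subseteq> M \<and> ediam d (U n) \<le> ennreal \<delta>) \<and> E \<subseteq> (\<Union>n. U n)}.
        \<Sum>n. ennreal (enn2real (ediam d (U n)) powr s))"

definition hausdorff_measure ::
    "'a set \<Rightarrow> ('a \<Rightarrow> 'a \<Rightarrow> real) \<Rightarrow> real \<Rightarrow> 'a set \<Rightarrow> ennreal" where
  "hausdorff_measure M d s E = (SUP \<delta>\<in>{0<..}. hausdorff_premeasure M d s \<delta> E)"

definition hausdorff_dim :: "'a set \<Rightarrow> ('a \<Rightarrow> 'a \<Rightarrow> real) \<Rightarrow> 'a set \<Rightarrow> ennreal" where
  "hausdorff_dim M d E = Inf {ennreal s | s. s > 0 \<and> hausdorff_measure M d s E = 0}"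


section \<open>Well-definedness of the notions above\<close>

lemma quotient_of_cross:
  assumes "b \<noteq> 0"
  shows "a * snd (quotient_of (of_int a / of_int b)) = fst (quotient_of (of_int a / of_int b)) * b"
proof -
  obtain n d where nd: "quotient_of (of_int a / of_int b) = (n, d)" by (cases "quotient_of (of_int a / of_int b)")
  have d: "d > 0" using quotient_of_denom_pos[OF nd] .
  have "(of_int a / of_int b :: rat) = of_int n / of_int d" using quotient_of_div[OF nd] .
  then have "(of_int a * of_int d :: rat) = of_int n * of_int b"
    using d assms by (simp add: field_simps)
  then have "a * d = n * b" by (metis of_int_eq_iff of_int_mult)
  then show ?thesis using nd by simp
qed

lemma rat_pval_frac:
  assumes p: "prime p" and "a \<noteq> 0" "b \<noteq> 0"
  shows "rat_pval p (of_int a / of_int b) = int (multiplicity (int p) a) - int (multiplicity (int p) b)"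
proof -
  define n d where "n = fst (quotient_of (of_int a / of_int b))" and "d = snd (quotient_of (of_int a / of_int b))"
  have eq: "a * d = n * b" using quotient_of_cross[OF \<open>b \<noteq> 0\<close>] by (simp add: n_def d_def)
  have d: "d \<noteq> 0" unfolding d_def using quotient_of_denom_pos' by (metis less_irrefl)
  have n: "n \<noteq> 0" using eq assms d by auto
  have pe: "prime_elem (int p)" using p by (simp add: prime_imp_prime_elem)
  have "multiplicity (int p) a + multiplicity (int p) d = multiplicity (int p) n + multiplicity (int p) b"
    using eq prime_elem_multiplicity_mult_distrib[OF pe] assms d n by metis
  then show ?thesis unfolding rat_pval_def n_def[symmetric] d_def[symmetric] by linarith
qed

lemma rat_frac_cases:
  fixes q :: rat
  obtains a b where "q = of_int a / of_int b" "b \<noteq> 0"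
proof -
  obtain n d where nd: "quotient_of q = (n, d)" by (cases "quotient_of q")
  show ?thesis using that quotient_of_div[OF nd] quotient_of_denom_pos[OF nd] by (metis less_irrefl)
qed

lemma rat_pabs_frac:
  assumes p: "prime p" and "a \<noteq> 0" "b \<noteq> 0"
  shows "rat_pabs p (of_int a / of_int b) = real p powi (int (multiplicity (int p) b) - int (multiplicity (int p) a))"
  using rat_pval_frac[OF assms] assms unfolding rat_pabs_def by simp

lemma rat_pabs_0 [simp]: "rat_pabs p 0 = 0" by (simp add: rat_pabs_def)

lemma rat_pabs_nonneg [simp]: "rat_pabs p q \<ge> 0" by (simp add: rat_pabs_def)

lemma rat_pabs_eq_0_iff: "prime p \<Longrightarrow> rat_pabs p q = 0 \<longleftrightarrow> q = 0"
  by (auto simp: rat_pabs_def prime_gt_0_nat)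

lemma rat_pabs_1 [simp]: "prime p \<Longrightarrow> rat_pabs p 1 = 1"
  using rat_pabs_frac[of p 1 1] by simp

lemma rat_pabs_mult:
  assumes p: "prime p"
  shows "rat_pabs p (q * r) = rat_pabs p q * rat_pabs p r"
proof (cases "q = 0 \<or> r = 0")
  case False
  obtain a b where q: "q = of_int a / of_int b" "b \<noteq> 0" by (rule rat_frac_cases)
  obtain c d where r: "r = of_int c / of_int d" "d \<noteq> 0" by (rule rat_frac_cases)
  have nz: "a \<noteq> 0" "c \<noteq> 0" using False q r by auto
  have pe: "prime_elem (int p)" using p by (simp add: prime_imp_prime_elem)
  have p0: "real p \<noteq> 0" using p by (auto simp: prime_gt_0_nat)
  have e: "q * r = of_int (a * c) / of_int (b * d)" using q r by simp
  have "rat_pabs p (q * r) = real p powi (int (multiplicity (int p) (b * d)) - int (multiplicity (int p) (a * c)))"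
    unfolding e using nz q r by (intro rat_pabs_frac[OF p]) auto
  also have "\<dots> = real p powi ((int (multiplicity (int p) b) - int (multiplicity (int p) a))
                           + (int (multiplicity (int p) d) - int (multiplicity (int p) c)))"
    using nz q r by (simp add: prime_elem_multiplicity_mult_distrib[OF pe] algebra_simps)
  also have "\<dots> = rat_pabs p q * rat_pabs p r"
    unfolding q(1) r(1) using nz q r p0 by (simp add: rat_pabs_frac[OF p] power_int_add)
  finally show ?thesis .
qed auto

lemma rat_pabs_minus [simp]:
  assumes p: "prime p" shows "rat_pabs p (- q) = rat_pabs p q"
proof -
  have "rat_pabs p (-1) = 1" using multiplicity_unit_right[of "-1" "int p"]
    by (simp add: rat_pabs_def rat_pval_def)
  then show ?thesis using rat_pabs_mult[OF p, of "-1" q] by simp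
qed

lemma rat_pabs_add:
  assumes p: "prime p"
  shows "rat_pabs p (q + r) \<le> max (rat_pabs p q) (rat_pabs p r)"
proof (cases "q = 0 \<or> r = 0 \<or> q + r = 0")
  case False
  obtain a b where q: "q = of_int a / of_int b" "b \<noteq> 0" by (rule rat_frac_cases)
  obtain c d where r: "r = of_int c / of_int d" "d \<noteq> 0" by (rule rat_frac_cases)
  have nz: "a * d \<noteq> 0" "c * b \<noteq> 0" "b * d \<noteq> 0" using False q r by auto
  have q': "q = of_int (a * d) / of_int (b * d)" and r': "r = of_int (c * b) / of_int (b * d)"
    using q r by auto
  have e: "q + r = of_int (a * d + c * b) / of_int (b * d)" using q r by (simp add: field_simps)
  have nz4: "a * d + c * b \<noteq> 0" using False e by (metis div_0 of_int_0)
  define m where "m = min (multiplicity (int p) (a * d)) (multiplicity (int p) (c * b))"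
  have "int p ^ m dvd a * d" "int p ^ m dvd c * b"
    unfolding m_def by (auto intro!: multiplicity_dvd')
  then have "int p ^ m dvd a * d + c * b" by simp
  moreover have "\<not> is_unit (int p)" using p by (simp add: prime_nat_iff)
  ultimately have m: "m \<le> multiplicity (int p) (a * d + c * b)"
    using nz4 by (intro multiplicity_geI) auto
  have p1: "1 \<le> real p" using prime_ge_1_nat[OF p] by simp
  have "rat_pabs p (q + r) = real p powi (int (multiplicity (int p) (b * d)) - int (multiplicity (int p) (a * d + c * b)))"
    unfolding e by (rule rat_pabs_frac[OF p nz4 nz(3)])
  also have "\<dots> \<le> real p powi (int (multiplicity (int p) (b * d)) - int m)"
    using m p1 by (intro power_int_increasing) auto
  also have "\<dots> \<le> max (rat_pabs p q) (rat_pabs p r)"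
    unfolding q' r' rat_pabs_frac[OF p nz(1) nz(3)] rat_pabs_frac[OF p nz(2) nz(3)] m_def
    by (auto simp: min_def)
  finally show ?thesis .
qed (auto simp: le_max_iff_disj)

lemma rat_pabs_diff:
  "prime p \<Longrightarrow> rat_pabs p (q - r) \<le> max (rat_pabs p q) (rat_pabs p r)"
  using rat_pabs_add[of p q "- r"] by simp

lemma rat_pabs_commute: "prime p \<Longrightarrow> rat_pabs p (q - r) = rat_pabs p (r - q)"
  by (metis minus_diff_eq rat_pabs_minus)

lemma rat_pabs_abs_diff:
  assumes p: "prime p"
  shows "\<bar>rat_pabs p q - rat_pabs p r\<bar> \<le> rat_pabs p (q - r)"
proof -
  have "rat_pabs p q \<le> max (rat_pabs p (q - r)) (rat_pabs p r)"
    using rat_pabs_add[OF p, of "q - r" r] by simp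
  moreover have "rat_pabs p r \<le> max (rat_pabs p (q - r)) (rat_pabs p q)"
    using rat_pabs_add[OF p, of "r - q" q] by (simp add: rat_pabs_commute[OF p])
  ultimately show ?thesis
    using rat_pabs_nonneg[of p q] rat_pabs_nonneg[of p r] rat_pabs_nonneg[of p "q - r"] by linarith
qed

lemma padic_cauchy_convergent:
  assumes p: "prime p" and a: "a \<in> padic_cauchy p"
  shows "convergent (\<lambda>n. rat_pabs p (a n))"
proof -
  have "Cauchy (\<lambda>n. rat_pabs p (a n))"
  proof (rule metric_CauchyI)
    fix e :: real assume "e > 0"
    then obtain N where N: "\<forall>m\<ge>N. \<forall>n\<ge>N. rat_pabs p (a m - a n) < e"
      using a unfolding padic_cauchy_def by blast
    have "dist (rat_pabs p (a m)) (rat_pabs p (a n)) < e" if "m \<ge> N" "n \<ge> N" for m n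
      using rat_pabs_abs_diff[OF p, of "a m" "a n"] N that unfolding dist_real_def by fastforce
    then show "\<exists>M. \<forall>m\<ge>M. \<forall>n\<ge>M. dist (rat_pabs p (a m)) (rat_pabs p (a n)) < e" by blast
  qed
  then show ?thesis by (simp add: Cauchy_convergent_iff)
qed

lemma padic_cauchy_add:
  assumes p: "prime p" and a: "a \<in> padic_cauchy p" and b: "b \<in> padic_cauchy p"
  shows "(\<lambda>n. a n + b n) \<in> padic_cauchy p"
  unfolding padic_cauchy_def
proof (intro CollectI allI impI)
  fix e :: real assume e: "e > 0"
  obtain N where N: "\<forall>m\<ge>N. \<forall>n\<ge>N. rat_pabs p (a m - a n) < e"
    using a e unfolding padic_cauchy_def by blast
  obtain M where M: "\<forall>m\<ge>M. \<forall>n\<ge>M. rat_pabs p (b m - b n) < e"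
    using b e unfolding padic_cauchy_def by blast
  have "rat_pabs p (a m + b m - (a n + b n)) < e" if "m \<ge> max M N" "n \<ge> max M N" for m n
  proof -
    have "a m + b m - (a n + b n) = (a m - a n) + (b m - b n)" by simp
    then have "rat_pabs p (a m + b m - (a n + b n)) \<le> max (rat_pabs p (a m - a n)) (rat_pabs p (b m - b n))"
      using rat_pabs_add[OF p] by metis
    moreover have "rat_pabs p (a m - a n) < e" "rat_pabs p (b m - b n) < e" using N M that by auto
    ultimately show ?thesis by linarith
  qed
  then show "\<exists>N. \<forall>m\<ge>N. \<forall>n\<ge>N. rat_pabs p (a m + b m - (a n + b n)) < e" by blast
qed

lemma padic_cauchy_const [simp]: "(\<lambda>_. q) \<in> padic_cauchy p"
  by (simp add: padic_cauchy_def)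

lemma padic_cauchy_bounded:
  assumes p: "prime p" and a: "a \<in> padic_cauchy p"
  obtains K where "K > 0" "\<And>n. rat_pabs p (a n) \<le> K"
proof -
  have "Bseq (\<lambda>n. rat_pabs p (a n))" using padic_cauchy_convergent[OF assms] by (rule convergent_imp_Bseq)
  then obtain K where "K > 0" "\<forall>n. norm (rat_pabs p (a n)) \<le> K" unfolding Bseq_def by blast
  then show ?thesis using that[of K] by simp
qed

lemma padic_cauchy_mult:
  assumes p: "prime p" and a: "a \<in> padic_cauchy p" and b: "b \<in> padic_cauchy p"
  shows "(\<lambda>n. a n * b n) \<in> padic_cauchy p"
  unfolding padic_cauchy_def
proof (intro CollectI allI impI)
  fix e :: real assume e: "e > 0"
  obtain K where K: "K > 0" "\<And>n. rat_pabs p (a n) \<le> K" using padic_cauchy_bounded[OF p a] by metis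
  obtain L where L: "L > 0" "\<And>n. rat_pabs p (b n) \<le> L" using padic_cauchy_bounded[OF p b] by metis
  have eLK: "e / L > 0" "e / K > 0" using e K L by auto
  obtain N where N: "\<forall>m\<ge>N. \<forall>n\<ge>N. rat_pabs p (a m - a n) < e / L"
    using a eLK(1) unfolding padic_cauchy_def by blast
  obtain M where M: "\<forall>m\<ge>M. \<forall>n\<ge>M. rat_pabs p (b m - b n) < e / K"
    using b eLK(2) unfolding padic_cauchy_def by blast
  have "rat_pabs p (a m * b m - a n * b n) < e" if mn: "m \<ge> max M N" "n \<ge> max M N" for m n
  proof -
    have "a m * b m - a n * b n = a m * (b m - b n) + (a m - a n) * b n" by (simp add: algebra_simps)
    then have "rat_pabs p (a m * b m - a n * b n) \<le> max (rat_pabs p (a m * (b m - b n))) (rat_pabs p ((a m - a n) * b n))"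
      using rat_pabs_add[OF p] by metis
    moreover have "rat_pabs p (a m * (b m - b n)) < e"
    proof -
      have "rat_pabs p (a m * (b m - b n)) \<le> K * rat_pabs p (b m - b n)"
        using K rat_pabs_mult[OF p] by (simp add: mult_right_mono)
      also have "\<dots> < K * (e / K)" using M mn K by (intro mult_strict_left_mono) auto
      finally show ?thesis using K by simp
    qed
    moreover have "rat_pabs p ((a m - a n) * b n) < e"
    proof -
      have "rat_pabs p ((a m - a n) * b n) \<le> rat_pabs p (a m - a n) * L"
        using L rat_pabs_mult[OF p] by (simp add: mult_left_mono)
      also have "\<dots> < e / L * L" using N mn L by (intro mult_strict_right_mono) auto
      finally show ?thesis using L by simp
    qed
    ultimately show ?thesis by linarith
  qed
  then show "\<exists>N. \<forall>m\<ge>N. \<forall>n\<ge>N. rat_pabs p (a m * b m - a n * b n) < e" by blast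
qed

lemma padic_cauchy_minus: "prime p \<Longrightarrow> a \<in> padic_cauchy p \<Longrightarrow> (\<lambda>n. - a n) \<in> padic_cauchy p"
  using padic_cauchy_mult[of p "\<lambda>_. -1" a] by simp

lemma padic_cauchy_cring:
  assumes p: "prime p" shows "cring (padic_cauchy_ring p)"
proof (rule cringI)
  show "abelian_group (padic_cauchy_ring p)"
  proof (rule abelian_groupI)
    fix x assume "x \<in> carrier (padic_cauchy_ring p)"
    then show "\<exists>y\<in>carrier (padic_cauchy_ring p). y \<oplus>\<^bsub>padic_cauchy_ring p\<^esub> x = \<zero>\<^bsub>padic_cauchy_ring p\<^esub>"
      using padic_cauchy_minus[OF p] by (intro bexI[of _ "\<lambda>n. - x n"]) (auto simp: padic_cauchy_ring_def)
  qed (auto simp: padic_cauchy_ring_def padic_cauchy_add[OF p] algebra_simps)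
  show "comm_monoid (padic_cauchy_ring p)"
    by (rule comm_monoidI) (auto simp: padic_cauchy_ring_def padic_cauchy_mult[OF p] algebra_simps)
qed (auto simp: padic_cauchy_ring_def algebra_simps)

lemma padic_null_ideal:
  assumes p: "prime p" shows "ideal (padic_null p) (padic_cauchy_ring p)"
proof -
  interpret R: cring "padic_cauchy_ring p" by (rule padic_cauchy_cring[OF p])
  have add: "(\<lambda>n. a n + b n) \<in> padic_null p" if "a \<in> padic_null p" "b \<in> padic_null p" for a b
  proof -
    have "(\<lambda>n. rat_pabs p (a n) + rat_pabs p (b n)) \<longlonglongrightarrow> 0"
      using that tendsto_add[of "\<lambda>n. rat_pabs p (a n)" 0 sequentially "\<lambda>n. rat_pabs p (b n)" 0]
      by (simp add: padic_null_def)
    moreover have "rat_pabs p (a n + b n) \<le> rat_pabs p (a n) + rat_pabs p (b n)" for n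
      using rat_pabs_add[OF p, of "a n" "b n"] rat_pabs_nonneg[of p "a n"] rat_pabs_nonneg[of p "b n"] by linarith
    ultimately have "(\<lambda>n. rat_pabs p (a n + b n)) \<longlonglongrightarrow> 0"
      by (auto intro!: Lim_null_comparison[of _ "\<lambda>n. rat_pabs p (a n) + rat_pabs p (b n)"])
    then show ?thesis using that padic_cauchy_add[OF p] by (simp add: padic_null_def)
  qed
  have mult: "(\<lambda>n. b n * a n) \<in> padic_null p" if "a \<in> padic_null p" and b: "b \<in> padic_cauchy p" for a b
  proof -
    obtain L where L: "L > 0" "\<And>n. rat_pabs p (b n) \<le> L" using padic_cauchy_bounded[OF p b] by metis
    have "(\<lambda>n. L * rat_pabs p (a n)) \<longlonglongrightarrow> 0"
      using that tendsto_mult[of "\<lambda>n. L" L sequentially "\<lambda>n. rat_pabs p (a n)" 0]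
      by (simp add: padic_null_def)
    moreover have "rat_pabs p (b n * a n) \<le> L * rat_pabs p (a n)" for n
      using L by (simp add: rat_pabs_mult[OF p] mult_right_mono)
    ultimately have "(\<lambda>n. rat_pabs p (b n * a n)) \<longlonglongrightarrow> 0"
      by (auto intro!: Lim_null_comparison[of _ "\<lambda>n. L * rat_pabs p (a n)"])
    then show ?thesis using that padic_cauchy_mult[OF p] by (simp add: padic_null_def)
  qed
  have inv: "\<ominus>\<^bsub>padic_cauchy_ring p\<^esub> a = (\<lambda>n. - a n)" if "a \<in> padic_cauchy p" for a
    by (rule R.minus_equality) (use that padic_cauchy_minus[OF p] in \<open>auto simp: padic_cauchy_ring_def\<close>)
  show ?thesis
  proof (rule idealI)
    show "ring (padic_cauchy_ring p)" by (rule R.ring_axioms)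
    show "subgroup (padic_null p) (add_monoid (padic_cauchy_ring p))"
    proof
      show "padic_null p \<subseteq> carrier (add_monoid (padic_cauchy_ring p))"
        by (auto simp: padic_null_def padic_cauchy_ring_def)
      show "\<one>\<^bsub>add_monoid (padic_cauchy_ring p)\<^esub> \<in> padic_null p"
        by (auto simp: padic_null_def padic_cauchy_ring_def)
      fix x assume x: "x \<in> padic_null p"
      have "inv\<^bsub>add_monoid (padic_cauchy_ring p)\<^esub> x = (\<lambda>n. - x n)"
        using inv[of x] x by (simp add: a_inv_def padic_null_def)
      then show "inv\<^bsub>add_monoid (padic_cauchy_ring p)\<^esub> x \<in> padic_null p"
        using mult[OF x, of "\<lambda>_. -1"] by simp
    qed (auto simp: padic_cauchy_ring_def add)
    fix a x assume "a \<in> padic_null p" "x \<in> carrier (padic_cauchy_ring p)"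
    then show "x \<otimes>\<^bsub>padic_cauchy_ring p\<^esub> a \<in> padic_null p" "a \<otimes>\<^bsub>padic_cauchy_ring p\<^esub> x \<in> padic_null p"
      using mult[of a x] by (auto simp: padic_cauchy_ring_def mult.commute)
  qed
qed

lemma Qp_cring: "prime p \<Longrightarrow> cring (Qp p)"
  unfolding Qp_def by (intro ideal.quotient_is_cring padic_null_ideal padic_cauchy_cring)

abbreviation padic_class :: "nat \<Rightarrow> (nat \<Rightarrow> rat) \<Rightarrow> (nat \<Rightarrow> rat) set" where
  "padic_class p a \<equiv> padic_null p +>\<^bsub>padic_cauchy_ring p\<^esub> a"

lemma Qp_class_hom: "prime p \<Longrightarrow> ring_hom_cring (padic_cauchy_ring p) (Qp p) (padic_class p)"
  unfolding Qp_def by (intro ideal.rcos_ring_hom_cring padic_null_ideal padic_cauchy_cring)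

lemma Qp_cases:
  assumes "x \<in> carrier (Qp p)"
  obtains a where "a \<in> padic_cauchy p" "x = padic_class p a"
  using assms that unfolding Qp_def FactRing_def A_RCOSETS_def'
  by (auto simp: padic_cauchy_ring_def)

lemma padic_class_mem: "padic_class p a = {(\<lambda>n. h n + a n) | h. h \<in> padic_null p}"
  by (auto simp: a_r_coset_def' padic_cauchy_ring_def)

lemma padic_abs_class:
  assumes p: "prime p" and a: "a \<in> padic_cauchy p"
  shows "(\<lambda>n. rat_pabs p (a n)) \<longlonglongrightarrow> padic_abs p (padic_class p a)"
proof -
  obtain r where r: "(\<lambda>n. rat_pabs p (a n)) \<longlonglongrightarrow> r"
    using padic_cauchy_convergent[OF assms] by (auto simp: convergent_def)
  have all: "(\<lambda>n. rat_pabs p (b n)) \<longlonglongrightarrow> r" if b: "b \<in> padic_class p a" for b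
  proof -
    obtain h where h: "h \<in> padic_null p" "b = (\<lambda>n. h n + a n)" using b by (auto simp: padic_class_mem)
    have "(\<lambda>n. rat_pabs p (b n) - rat_pabs p (a n)) \<longlonglongrightarrow> 0"
    proof (rule Lim_null_comparison)
      show "(\<lambda>n. rat_pabs p (h n)) \<longlonglongrightarrow> 0" using h by (simp add: padic_null_def)
      have "norm (rat_pabs p (b n) - rat_pabs p (a n)) \<le> rat_pabs p (h n)" for n
        using rat_pabs_abs_diff[OF p, of "b n" "a n"] h by simp
      then show "\<forall>\<^sub>F n in sequentially. norm (rat_pabs p (b n) - rat_pabs p (a n)) \<le> rat_pabs p (h n)"
        by simp
    qed
    from tendsto_add[OF this r] show ?thesis by simp
  qed
  have mem: "a \<in> padic_class p a"
    unfolding padic_class_mem by (auto intro!: exI[of _ "\<lambda>_. 0"] simp: padic_null_def)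
  have "padic_abs p (padic_class p a) = r"
    unfolding padic_abs_def
  proof (rule the_equality)
    show "\<forall>b\<in>padic_class p a. (\<lambda>n. rat_pabs p (b n)) \<longlonglongrightarrow> r" using all by blast
    show "r' = r" if "\<forall>b\<in>padic_class p a. (\<lambda>n. rat_pabs p (b n)) \<longlonglongrightarrow> r'" for r'
      using that mem r LIMSEQ_unique by blast
  qed
  then show ?thesis using r by simp
qed

lemma Qp_class_simps:
  assumes p: "prime p"
  shows "a \<in> padic_cauchy p \<Longrightarrow> b \<in> padic_cauchy p \<Longrightarrow>
           padic_class p a \<oplus>\<^bsub>Qp p\<^esub> padic_class p b = padic_class p (\<lambda>n. a n + b n)"
    and "a \<in> padic_cauchy p \<Longrightarrow> b \<in> padic_cauchy p \<Longrightarrow>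
           padic_class p a \<ominus>\<^bsub>Qp p\<^esub> padic_class p b = padic_class p (\<lambda>n. a n - b n)"
    and "a \<in> padic_cauchy p \<Longrightarrow> \<ominus>\<^bsub>Qp p\<^esub> padic_class p a = padic_class p (\<lambda>n. - a n)"
    and "\<zero>\<^bsub>Qp p\<^esub> = padic_class p (\<lambda>_. 0)"
    and "a \<in> padic_cauchy p \<Longrightarrow> padic_class p a \<in> carrier (Qp p)"
proof -
  interpret h: ring_hom_cring "padic_cauchy_ring p" "Qp p" "padic_class p"
    by (rule Qp_class_hom[OF p])
  have c: "carrier (padic_cauchy_ring p) = padic_cauchy p" by (simp add: padic_cauchy_ring_def)
  have inv: "\<ominus>\<^bsub>padic_cauchy_ring p\<^esub> a = (\<lambda>n. - a n)" if "a \<in> padic_cauchy p" for a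
    by (rule h.R.minus_equality) (use that padic_cauchy_minus[OF p] in \<open>auto simp: padic_cauchy_ring_def\<close>)
  show add: "padic_class p a \<oplus>\<^bsub>Qp p\<^esub> padic_class p b = padic_class p (\<lambda>n. a n + b n)"
    if "a \<in> padic_cauchy p" "b \<in> padic_cauchy p" for a b
    using h.hom_add[of a b] that unfolding c by (simp add: padic_cauchy_ring_def)
  show neg: "\<ominus>\<^bsub>Qp p\<^esub> padic_class p a = padic_class p (\<lambda>n. - a n)" if "a \<in> padic_cauchy p" for a
    using h.hom_a_inv[of a] that unfolding c by (simp add: inv)
  show "padic_class p a \<ominus>\<^bsub>Qp p\<^esub> padic_class p b = padic_class p (\<lambda>n. a n - b n)"
    if "a \<in> padic_cauchy p" "b \<in> padic_cauchy p"
    using add[OF that(1) padic_cauchy_minus[OF p that(2)]] neg[OF that(2)] by (simp add: a_minus_def)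
  show "\<zero>\<^bsub>Qp p\<^esub> = padic_class p (\<lambda>_. 0)"
    using h.hom_zero by (simp add: padic_cauchy_ring_def)
  show "padic_class p a \<in> carrier (Qp p)" if "a \<in> padic_cauchy p"
    using h.hom_closed that c by blast
qed

lemma padic_abs_nonneg:
  assumes "prime p" "x \<in> carrier (Qp p)" shows "padic_abs p x \<ge> 0"
  using assms(2)
proof (rule Qp_cases)
  fix a assume "a \<in> padic_cauchy p" "x = padic_class p a"
  then show ?thesis using LIMSEQ_le_const[OF padic_abs_class[OF assms(1)], of a 0] by simp
qed

lemma padic_abs_zero_iff:
  assumes p: "prime p" and x: "x \<in> carrier (Qp p)" shows "padic_abs p x = 0 \<longleftrightarrow> x = \<zero>\<^bsub>Qp p\<^esub>"
  using x
proof (rule Qp_cases)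
  fix a assume a: "a \<in> padic_cauchy p" "x = padic_class p a"
  interpret I: ideal "padic_null p" "padic_cauchy_ring p" by (rule padic_null_ideal[OF p])
  show ?thesis
  proof
    assume "padic_abs p x = 0"
    then have "a \<in> padic_null p" using padic_abs_class[OF p a(1)] a by (simp add: padic_null_def)
    then have "padic_class p a = padic_null p" by (rule I.a_rcos_const)
    then show "x = \<zero>\<^bsub>Qp p\<^esub>" using a by (simp add: Qp_def FactRing_def)
  next
    assume "x = \<zero>\<^bsub>Qp p\<^esub>"
    then have "x = padic_class p (\<lambda>_. 0)" using Qp_class_simps(4)[OF p] by simp
    then show "padic_abs p x = 0" using padic_abs_class[OF p padic_cauchy_const[of 0]]
      by (simp add: LIMSEQ_const_iff)
  qed
qed

lemma padic_abs_add:
  assumes p: "prime p" and x: "x \<in> carrier (Qp p)" and y: "y \<in> carrier (Qp p)"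
  shows "padic_abs p (x \<oplus>\<^bsub>Qp p\<^esub> y) \<le> max (padic_abs p x) (padic_abs p y)"
proof -
  obtain a where a: "a \<in> padic_cauchy p" "x = padic_class p a" using x by (rule Qp_cases)
  obtain b where b: "b \<in> padic_cauchy p" "y = padic_class p b" using y by (rule Qp_cases)
  have s: "(\<lambda>n. rat_pabs p (a n + b n)) \<longlonglongrightarrow> padic_abs p (x \<oplus>\<^bsub>Qp p\<^esub> y)"
    using padic_abs_class[OF p padic_cauchy_add[OF p a(1) b(1)]] Qp_class_simps(1)[OF p a(1) b(1)] a b by simp
  show ?thesis
    unfolding a(2) b(2)
    by (rule LIMSEQ_le[OF s[unfolded a(2) b(2)] tendsto_max[OF padic_abs_class[OF p a(1)] padic_abs_class[OF p b(1)]]])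
       (use rat_pabs_add[OF p] in auto)
qed

lemma padic_abs_uminus:
  assumes p: "prime p" and x: "x \<in> carrier (Qp p)"
  shows "padic_abs p (\<ominus>\<^bsub>Qp p\<^esub> x) = padic_abs p x"
proof -
  obtain a where a: "a \<in> padic_cauchy p" "x = padic_class p a" using x by (rule Qp_cases)
  have "(\<lambda>n. rat_pabs p (a n)) \<longlonglongrightarrow> padic_abs p (\<ominus>\<^bsub>Qp p\<^esub> x)"
    using padic_abs_class[OF p padic_cauchy_minus[OF p a(1)]] a Qp_class_simps(3)[OF p] p by simp
  then show ?thesis using padic_abs_class[OF p a(1)] a LIMSEQ_unique by blast
qed

lemma padic_abs_of_rat:
  assumes p: "prime p" shows "padic_abs p (padic_of_rat p q) = rat_pabs p q"
  using padic_abs_class[OF p padic_cauchy_const[of q]] unfolding padic_of_rat_def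
  by (simp add: LIMSEQ_const_iff)

lemma cover_group_simps [simp]:
  "carrier cover_group = cover_carrier"
  "x \<otimes>\<^bsub>cover_group\<^esub> z = (fst x + fst z, \<lambda>p\<in>primes. snd x p \<oplus>\<^bsub>Qp p\<^esub> snd z p)"
  "\<one>\<^bsub>cover_group\<^esub> = (0, \<lambda>p\<in>primes. \<zero>\<^bsub>Qp p\<^esub>)"
  by (simp_all add: cover_group_def)

lemma cover_coord: "x \<in> cover_carrier \<Longrightarrow> prime p \<Longrightarrow> snd x p \<in> carrier (Qp p)"
  by (auto simp: cover_carrier_def)

lemma cover_eqI:
  assumes "x \<in> cover_carrier" "z \<in> cover_carrier" "fst x = fst z"
    and "\<And>p. prime p \<Longrightarrow> snd x p = snd z p"
  shows "x = z"
proof (rule prod_eqI)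
  show "snd x = snd z"
    by (rule PiE_ext[of _ primes "\<lambda>p. carrier (Qp p)"]) (use assms in \<open>auto simp: cover_carrier_def\<close>)
qed fact

lemma Zp_add: "prime p \<Longrightarrow> x \<in> Zp p \<Longrightarrow> z \<in> Zp p \<Longrightarrow> x \<oplus>\<^bsub>Qp p\<^esub> z \<in> Zp p"
  using padic_abs_add[of p x z] cring.cring_simprules(1)[OF Qp_cring, of p x z]
  by (auto simp: Zp_def)

lemma Zp_uminus: "prime p \<Longrightarrow> x \<in> Zp p \<Longrightarrow> \<ominus>\<^bsub>Qp p\<^esub> x \<in> Zp p"
  using padic_abs_uminus[of p x] cring.cring_simprules(3)[OF Qp_cring, of p x]
  by (auto simp: Zp_def)

lemma Zp_zero: "prime p \<Longrightarrow> \<zero>\<^bsub>Qp p\<^esub> \<in> Zp p"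
  using padic_abs_zero_iff[of p "\<zero>\<^bsub>Qp p\<^esub>"] cring.cring_simprules(2)[OF Qp_cring, of p]
  by (auto simp: Zp_def)

lemma cover_add_closed:
  assumes x: "x \<in> cover_carrier" and z: "z \<in> cover_carrier"
  shows "(fst x + fst z, \<lambda>p\<in>primes. snd x p \<oplus>\<^bsub>Qp p\<^esub> snd z p) \<in> cover_carrier"
proof -
  have "{p\<in>primes. snd x p \<oplus>\<^bsub>Qp p\<^esub> snd z p \<notin> Zp p}
      \<subseteq> {p\<in>primes. snd x p \<notin> Zp p} \<union> {p\<in>primes. snd z p \<notin> Zp p}"
    using Zp_add by blast
  moreover have "finite ({p\<in>primes. snd x p \<notin> Zp p} \<union> {p\<in>primes. snd z p \<notin> Zp p})"
    using x z by (auto simp: cover_carrier_def)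
  ultimately have "finite {p\<in>primes. snd x p \<oplus>\<^bsub>Qp p\<^esub> snd z p \<notin> Zp p}"
    by (rule finite_subset)
  moreover have "{p\<in>primes. (\<lambda>p\<in>primes. snd x p \<oplus>\<^bsub>Qp p\<^esub> snd z p) p \<notin> Zp p}
      = {p\<in>primes. snd x p \<oplus>\<^bsub>Qp p\<^esub> snd z p \<notin> Zp p}" by auto
  ultimately show ?thesis
    using cover_coord[OF x] cover_coord[OF z] cring.cring_simprules(1)[OF Qp_cring]
    unfolding cover_carrier_def by (simp add: restrict_PiE_iff)
qed

lemma cover_uminus_closed:
  assumes x: "x \<in> cover_carrier"
  shows "(- fst x, \<lambda>p\<in>primes. \<ominus>\<^bsub>Qp p\<^esub> snd x p) \<in> cover_carrier"
proof -
  have "finite {p\<in>primes. \<ominus>\<^bsub>Qp p\<^esub> snd x p \<notin> Zp p}"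
    by (rule finite_subset[of _ "{p\<in>primes. snd x p \<notin> Zp p}"])
       (use Zp_uminus x in \<open>auto simp: cover_carrier_def\<close>)
  moreover have "{p\<in>primes. (\<lambda>p\<in>primes. \<ominus>\<^bsub>Qp p\<^esub> snd x p) p \<notin> Zp p}
      = {p\<in>primes. \<ominus>\<^bsub>Qp p\<^esub> snd x p \<notin> Zp p}" by auto
  ultimately show ?thesis
    using cover_coord[OF x] cring.cring_simprules(3)[OF Qp_cring]
    unfolding cover_carrier_def by (simp add: restrict_PiE_iff)
qed

lemma cover_zero_closed: "(0, \<lambda>p\<in>primes. \<zero>\<^bsub>Qp p\<^esub>) \<in> cover_carrier"
proof -
  have e: "{p\<in>primes. (\<lambda>p\<in>primes. \<zero>\<^bsub>Qp p\<^esub>) p \<notin> Zp p} = {}" using Zp_zero by auto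
  show ?thesis
    using cring.cring_simprules(2)[OF Qp_cring]
    unfolding cover_carrier_def by (simp add: restrict_PiE_iff e[simplified])
qed

lemma cover_comm_group: "comm_group cover_group"
proof (rule comm_groupI)
  fix x y z assume xyz: "x \<in> carrier cover_group" "y \<in> carrier cover_group" "z \<in> carrier cover_group"
  show "x \<otimes>\<^bsub>cover_group\<^esub> y \<otimes>\<^bsub>cover_group\<^esub> z = x \<otimes>\<^bsub>cover_group\<^esub> (y \<otimes>\<^bsub>cover_group\<^esub> z)"
    using xyz cring.cring_simprules(7)[OF Qp_cring] by (auto simp: cover_coord intro!: restrict_ext)
next
  fix x y assume xy: "x \<in> carrier cover_group" "y \<in> carrier cover_group"
  show "x \<otimes>\<^bsub>cover_group\<^esub> y \<in> carrier cover_group"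
    using xy by (simp add: cover_add_closed)
  show "x \<otimes>\<^bsub>cover_group\<^esub> y = y \<otimes>\<^bsub>cover_group\<^esub> x"
    using xy cring.cring_simprules(10)[OF Qp_cring] by (auto simp: cover_coord intro!: restrict_ext)
next
  fix x assume x: "x \<in> carrier cover_group"
  show "\<one>\<^bsub>cover_group\<^esub> \<otimes>\<^bsub>cover_group\<^esub> x = x"
  proof (rule cover_eqI)
    show "\<one>\<^bsub>cover_group\<^esub> \<otimes>\<^bsub>cover_group\<^esub> x \<in> cover_carrier"
      using cover_add_closed[OF cover_zero_closed, of x] x by simp
  qed (use x cring.cring_simprules(8)[OF Qp_cring] in \<open>auto simp: cover_coord\<close>)
  show "\<exists>y\<in>carrier cover_group. y \<otimes>\<^bsub>cover_group\<^esub> x = \<one>\<^bsub>cover_group\<^esub>"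
    using cover_uminus_closed[of x] x cring.cring_simprules(9)[OF Qp_cring]
    by (intro bexI[of _ "(- fst x, \<lambda>p\<in>primes. \<ominus>\<^bsub>Qp p\<^esub> snd x p)"])
       (auto simp: cover_coord intro!: restrict_ext)
qed (simp add: cover_zero_closed)

lemma padic_of_rat_closed: "prime p \<Longrightarrow> padic_of_rat p q \<in> carrier (Qp p)"
  unfolding padic_of_rat_def by (rule Qp_class_simps(5)) auto

lemma padic_of_rat_add: "prime p \<Longrightarrow> padic_of_rat p (q + r) = padic_of_rat p q \<oplus>\<^bsub>Qp p\<^esub> padic_of_rat p r"
  unfolding padic_of_rat_def by (subst Qp_class_simps(1)) auto

lemma padic_of_rat_0: "prime p \<Longrightarrow> padic_of_rat p 0 = \<zero>\<^bsub>Qp p\<^esub>"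
  unfolding padic_of_rat_def by (subst Qp_class_simps(4)) auto

lemma rat_pabs_gt_1D:
  assumes p: "prime p" and q: "q = of_int a / of_int b" "b \<noteq> 0" and "rat_pabs p q > 1"
  shows "int p dvd b"
proof (rule ccontr)
  assume "\<not> int p dvd b"
  then have m: "multiplicity (int p) b = 0" by (rule not_dvd_imp_multiplicity_0)
  have a: "a \<noteq> 0" using assms by (auto simp: rat_pabs_def)
  have "rat_pabs p q = real p powi (- int (multiplicity (int p) a))"
    using rat_pabs_frac[OF p a q(2)] m q by simp
  also have "\<dots> \<le> real p powi 0"
    using prime_ge_1_nat[OF p] by (intro power_int_increasing) auto
  finally show False using assms by simp
qed

lemma diag_embed_closed: "diag_embed q \<in> cover_carrier"
proof -
  obtain a b where q: "q = of_int a / of_int b" "b \<noteq> 0" by (rule rat_frac_cases)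
  have "finite {p\<in>primes. padic_of_rat p q \<notin> Zp p}"
  proof (rule finite_subset)
    show "{p\<in>primes. padic_of_rat p q \<notin> Zp p} \<subseteq> {p. p dvd nat \<bar>b\<bar>}"
      using rat_pabs_gt_1D[OF _ q]
      by (auto simp: Zp_def padic_of_rat_closed padic_abs_of_rat not_le)
    show "finite {p. p dvd nat \<bar>b\<bar>}" using q(2) by (intro finite_divisors_nat) auto
  qed
  moreover have "{p\<in>primes. (\<lambda>p\<in>primes. padic_of_rat p q) p \<notin> Zp p} = {p\<in>primes. padic_of_rat p q \<notin> Zp p}"
    by auto
  ultimately show ?thesis
    unfolding diag_embed_def cover_carrier_def by (simp add: restrict_PiE_iff padic_of_rat_closed)
qed

lemma diag_embed_add: "diag_embed (q + r) = diag_embed q \<otimes>\<^bsub>cover_group\<^esub> diag_embed r"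
  by (auto simp: diag_embed_def of_rat_add padic_of_rat_add intro!: restrict_ext)

lemma diag_embed_0: "diag_embed 0 = \<one>\<^bsub>cover_group\<^esub>"
  by (auto simp: diag_embed_def padic_of_rat_0 intro!: restrict_ext)

lemma diag_subgroup: "subgroup (range diag_embed) cover_group"
proof -
  interpret G: comm_group cover_group by (rule cover_comm_group)
  show ?thesis
  proof (rule G.subgroupI)
    show "range diag_embed \<subseteq> carrier cover_group" using diag_embed_closed by auto
    fix a assume "a \<in> range diag_embed"
    then obtain q where q: "a = diag_embed q" by auto
    have "diag_embed (- q) \<otimes>\<^bsub>cover_group\<^esub> diag_embed q = \<one>\<^bsub>cover_group\<^esub>"
      using diag_embed_add[of "- q" q] diag_embed_0 by simp
    then have "inv\<^bsub>cover_group\<^esub> a = diag_embed (- q)"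
      unfolding q by (intro G.inv_equality) (simp_all add: diag_embed_closed del: cover_group_simps(2,3))
    then show "inv\<^bsub>cover_group\<^esub> a \<in> range diag_embed" by (simp only: rangeI)
  next
    fix a b assume "a \<in> range diag_embed" "b \<in> range diag_embed"
    then obtain q r where "a = diag_embed q" "b = diag_embed r" by auto
    then have "a \<otimes>\<^bsub>cover_group\<^esub> b = diag_embed (q + r)" by (simp only: diag_embed_add)
    then show "a \<otimes>\<^bsub>cover_group\<^esub> b \<in> range diag_embed" by (simp only: rangeI)
  qed auto
qed

lemma diag_normal: "range diag_embed \<lhd> cover_group"
  by (intro comm_group.normal_iff_subgroup[THEN iffD2] cover_comm_group diag_subgroup)

lemma solenoid_comm_group: "comm_group solenoid"
  unfolding solenoid_def by (intro comm_group.abelian_FactGroup cover_comm_group diag_subgroup)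

lemma Qp_minus_closed: "prime p \<Longrightarrow> x \<in> carrier (Qp p) \<Longrightarrow> z \<in> carrier (Qp p) \<Longrightarrow> x \<ominus>\<^bsub>Qp p\<^esub> z \<in> carrier (Qp p)"
  using cring.cring_simprules(4)[OF Qp_cring] by blast

lemma cover_dist_bdd:
  assumes x: "x \<in> cover_carrier" and z: "z \<in> cover_carrier"
  shows "bdd_above ((\<lambda>p. padic_abs p (snd x p \<ominus>\<^bsub>Qp p\<^esub> snd z p) / real p) ` primes)"
proof -
  let ?f = "\<lambda>p. padic_abs p (snd x p \<ominus>\<^bsub>Qp p\<^esub> snd z p) / real p"
  let ?S = "{p\<in>primes. snd x p \<notin> Zp p} \<union> {p\<in>primes. snd z p \<notin> Zp p}"
  have fin: "finite ?S" using x z by (auto simp: cover_carrier_def)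
  have "?f p \<le> 1" if p: "prime p" "p \<notin> ?S" for p
  proof -
    have "snd x p \<ominus>\<^bsub>Qp p\<^esub> snd z p \<in> Zp p"
      using p Zp_add Zp_uminus unfolding a_minus_def by auto
    then have "padic_abs p (snd x p \<ominus>\<^bsub>Qp p\<^esub> snd z p) \<le> 1" by (simp add: Zp_def)
    then show ?thesis using prime_gt_1_nat[OF p(1)] by (simp add: divide_le_eq)
  qed
  then have "?f ` primes \<subseteq> ?f ` ?S \<union> {..1}" by auto
  moreover have "bdd_above (?f ` ?S \<union> {..1})" using fin by (simp only: bdd_above_Un) (auto intro!: bdd_above_finite)
  ultimately show ?thesis by (rule bdd_above_mono[rotated])
qed

lemma cover_dist_le_iff:
  assumes x: "x \<in> cover_carrier" and z: "z \<in> cover_carrier"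
  shows "cover_dist x z \<le> c \<longleftrightarrow> \<bar>fst x - fst z\<bar> \<le> c \<and>
           (\<forall>p. prime p \<longrightarrow> padic_abs p (snd x p \<ominus>\<^bsub>Qp p\<^esub> snd z p) \<le> real p * c)"
proof -
  have ne: "primes \<noteq> {}" using two_is_prime_nat by blast
  show ?thesis
    using x z cSUP_le_iff[OF ne cover_dist_bdd[OF x z], of c]
    by (auto simp: cover_dist_def divide_le_eq prime_gt_0_nat mult.commute)
qed

lemma cover_dist_ge:
  assumes x: "x \<in> cover_carrier" and z: "z \<in> cover_carrier"
  shows "\<bar>fst x - fst z\<bar> \<le> cover_dist x z"
    and "prime p \<Longrightarrow> padic_abs p (snd x p \<ominus>\<^bsub>Qp p\<^esub> snd z p) \<le> real p * cover_dist x z"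
  using cover_dist_le_iff[OF x z, of "cover_dist x z"] by auto

lemma cover_dist_nonneg: "cover_dist x z \<ge> 0"
  by (auto simp: cover_dist_def le_max_iff_disj)

lemma Qp_minus_commute:
  assumes p: "prime p" and x: "x \<in> carrier (Qp p)" and z: "z \<in> carrier (Qp p)"
  shows "padic_abs p (x \<ominus>\<^bsub>Qp p\<^esub> z) = padic_abs p (z \<ominus>\<^bsub>Qp p\<^esub> x)"
proof -
  interpret cring "Qp p" by (rule Qp_cring[OF p])
  have "x \<ominus>\<^bsub>Qp p\<^esub> z = \<ominus>\<^bsub>Qp p\<^esub> (z \<ominus>\<^bsub>Qp p\<^esub> x)" using x z by algebra
  then show ?thesis using padic_abs_uminus[OF p] x z by simp
qed

lemma cover_Metric_space: "Metric_space cover_carrier cover_dist"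
proof
  fix x y show "0 \<le> cover_dist x y" by (rule cover_dist_nonneg)
next
  fix x y
  have "cover_dist x y \<le> cover_dist y x" if "x \<in> cover_carrier" "y \<in> cover_carrier" for x y
    unfolding cover_dist_le_iff[OF that] using cover_dist_ge[OF that(2,1)] that
    by (auto simp: abs_minus_commute Qp_minus_commute[of _ "snd x _"] cover_coord)
  then show "cover_dist x y = cover_dist y x"
    by (cases "x \<in> cover_carrier \<and> y \<in> cover_carrier") (auto simp: cover_dist_def intro!: antisym)
next
  fix x y assume xy: "x \<in> cover_carrier" "y \<in> cover_carrier"
  have z: "x \<ominus>\<^bsub>Qp p\<^esub> y = \<zero>\<^bsub>Qp p\<^esub> \<longleftrightarrow> x = y" if "prime p" "x \<in> carrier (Qp p)" "y \<in> carrier (Qp p)" for x y p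
  proof -
    interpret cring "Qp p" by (rule Qp_cring[OF that(1)])
    have "x = (x \<ominus>\<^bsub>Qp p\<^esub> y) \<oplus>\<^bsub>Qp p\<^esub> y" using that by algebra
    then show ?thesis using that r_neg[of y] by (auto simp: minus_eq)
  qed
  have a: "padic_abs p (snd x p \<ominus>\<^bsub>Qp p\<^esub> snd y p) = 0 \<longleftrightarrow> snd x p = snd y p" if p: "prime p" for p
    using padic_abs_zero_iff[OF p Qp_minus_closed[OF p cover_coord[OF xy(1) p] cover_coord[OF xy(2) p]]]
       z[OF p cover_coord[OF xy(1) p] cover_coord[OF xy(2) p]] by simp
  have nn: "padic_abs p (snd x p \<ominus>\<^bsub>Qp p\<^esub> snd y p) \<ge> 0" if p: "prime p" for p
    using padic_abs_nonneg[OF p Qp_minus_closed[OF p cover_coord[OF xy(1) p] cover_coord[OF xy(2) p]]] .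
  have "cover_dist x y = 0 \<longleftrightarrow> cover_dist x y \<le> 0" using cover_dist_nonneg[of x y] by linarith
  also have "\<dots> \<longleftrightarrow> fst x = fst y \<and> (\<forall>p. prime p \<longrightarrow> snd x p = snd y p)"
    unfolding cover_dist_le_iff[OF xy] using a nn by (auto intro: antisym)
  also have "\<dots> \<longleftrightarrow> x = y" using cover_eqI[OF xy] by auto
  finally show "cover_dist x y = 0 \<longleftrightarrow> x = y" .
next
  fix x y z assume xyz: "x \<in> cover_carrier" "y \<in> cover_carrier" "z \<in> cover_carrier"
  show "cover_dist x z \<le> cover_dist x y + cover_dist y z"
    unfolding cover_dist_le_iff[OF xyz(1,3)]
  proof (intro conjI allI impI)
    show "\<bar>fst x - fst z\<bar> \<le> cover_dist x y + cover_dist y z"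
      using cover_dist_ge(1)[OF xyz(1,2)] cover_dist_ge(1)[OF xyz(2,3)] by linarith
    fix p :: nat assume p: "prime p"
    interpret cring "Qp p" by (rule Qp_cring[OF p])
    note c = cover_coord[OF xyz(1) p] cover_coord[OF xyz(2) p] cover_coord[OF xyz(3) p]
    have "snd x p \<ominus>\<^bsub>Qp p\<^esub> snd z p = (snd x p \<ominus>\<^bsub>Qp p\<^esub> snd y p) \<oplus>\<^bsub>Qp p\<^esub> (snd y p \<ominus>\<^bsub>Qp p\<^esub> snd z p)"
      using c by algebra
    then have "padic_abs p (snd x p \<ominus>\<^bsub>Qp p\<^esub> snd z p)
        \<le> max (padic_abs p (snd x p \<ominus>\<^bsub>Qp p\<^esub> snd y p)) (padic_abs p (snd y p \<ominus>\<^bsub>Qp p\<^esub> snd z p))"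
      using padic_abs_add[OF p minus_closed[OF c(1,2)] minus_closed[OF c(2,3)]] by simp
    also have "\<dots> \<le> real p * cover_dist x y + real p * cover_dist y z"
      using cover_dist_ge(2)[OF xyz(1,2) p] cover_dist_ge(2)[OF xyz(2,3) p]
        mult_nonneg_nonneg[OF _ cover_dist_nonneg[of x y], of "real p"] mult_nonneg_nonneg[OF _ cover_dist_nonneg[of y z], of "real p"]
      by simp
    finally show "padic_abs p (snd x p \<ominus>\<^bsub>Qp p\<^esub> snd z p) \<le> real p * (cover_dist x y + cover_dist y z)"
      by (simp add: algebra_simps)
  qed
qed

lemma cover_dist_translate:
  assumes h: "h \<in> cover_carrier" and x: "x \<in> cover_carrier" and z: "z \<in> cover_carrier"
  shows "cover_dist (h \<otimes>\<^bsub>cover_group\<^esub> x) (h \<otimes>\<^bsub>cover_group\<^esub> z) = cover_dist x z"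
proof -
  have "(snd h p \<oplus>\<^bsub>Qp p\<^esub> snd x p) \<ominus>\<^bsub>Qp p\<^esub> (snd h p \<oplus>\<^bsub>Qp p\<^esub> snd z p) = snd x p \<ominus>\<^bsub>Qp p\<^esub> snd z p" if p: "prime p" for p
  proof -
    interpret cring "Qp p" by (rule Qp_cring[OF p])
    show ?thesis using cover_coord[OF h p] cover_coord[OF x p] cover_coord[OF z p] by algebra
  qed
  then have "(SUP p\<in>primes. padic_abs p ((snd h p \<oplus>\<^bsub>Qp p\<^esub> snd x p) \<ominus>\<^bsub>Qp p\<^esub> (snd h p \<oplus>\<^bsub>Qp p\<^esub> snd z p)) / real p)
           = (SUP p\<in>primes. padic_abs p (snd x p \<ominus>\<^bsub>Qp p\<^esub> snd z p) / real p)"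
    by (intro SUP_cong) auto
  then show ?thesis
    using assms by (simp add: cover_dist_def cover_add_closed)
qed

lemma rat_eq_0_if_small:
  assumes s: "\<bar>of_rat q :: real\<bar> < 1" and p: "\<And>p. prime p \<Longrightarrow> rat_pabs p q < real p"
  shows "q = 0"
proof (rule ccontr)
  assume nz: "q \<noteq> 0"
  obtain n d where nd: "quotient_of q = (n, d)" by (cases "quotient_of q")
  have d: "d > 0" using quotient_of_denom_pos[OF nd] .
  have q: "q = of_int n / of_int d" using quotient_of_div[OF nd] .
  have n: "n \<noteq> 0" using nz q by auto
  have cop: "coprime n d" using quotient_of_coprime[OF nd] .
  have "d = 1"
  proof (rule ccontr)
    assume "d \<noteq> 1"
    then have "nat d \<noteq> 1" using d by auto
    then obtain p where p': "prime p" "p dvd nat d" using prime_factor_nat by blast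
    then have pd: "int p dvd d" using d by (metis int_dvd_int_iff int_nat_eq less_le)
    have "\<not> int p dvd n"
      using cop pd p'(1) by (metis coprime_common_divisor not_prime_unit prime_nat_int_transfer)
    then have mn: "multiplicity (int p) n = 0" by (rule not_dvd_imp_multiplicity_0)
    have "multiplicity (int p) d \<ge> 1"
      using pd d p'(1) by (intro multiplicity_geI) (auto simp: prime_nat_iff)
    then have "real p powi 1 \<le> rat_pabs p q"
      unfolding q rat_pabs_frac[OF p'(1) n less_imp_neq[OF d, symmetric]] mn
      using prime_ge_1_nat[OF p'(1)] by (intro power_int_increasing) auto
    then show False using p[OF p'(1)] by simp
  qed
  then have "q = of_int n" using q by simp
  then have "(of_rat q :: real) = of_int n" by (simp only: of_rat_of_int_eq)
  then have "real_of_int \<bar>n\<bar> < 1" using s by (simp only: of_int_abs)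
  then have "\<bar>n\<bar> < 1" by (simp only: of_int_less_1_iff)
  then show False using n by simp
qed

lemma carrier_solenoid: "carrier solenoid = solenoid_proj ` cover_carrier"
  by (auto simp: solenoid_def FactGroup_def RCOSETS_def solenoid_proj_def)

lemma solenoid_proj_mem:
  assumes "x \<in> cover_carrier"
  shows "solenoid_proj x = {diag_embed q \<otimes>\<^bsub>cover_group\<^esub> x | q. True}"
  by (auto simp: solenoid_proj_def r_coset_def)

lemma solenoid_proj_self: "x \<in> cover_carrier \<Longrightarrow> x \<in> solenoid_proj x"
  unfolding solenoid_proj_def
  using group.rcos_self[OF comm_group.axioms(2)[OF cover_comm_group] _ diag_subgroup] by simp

lemma solenoid_cosets:
  assumes "A \<in> carrier solenoid"
  shows "A \<noteq> {}" and "A \<subseteq> cover_carrier"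
    and "x \<in> A \<Longrightarrow> A = solenoid_proj x"
    and "x \<in> A \<Longrightarrow> diag_embed q \<otimes>\<^bsub>cover_group\<^esub> x \<in> A"
    and "x \<in> A \<Longrightarrow> z \<in> A \<Longrightarrow> \<exists>q. z = diag_embed q \<otimes>\<^bsub>cover_group\<^esub> x"
proof -
  interpret G: comm_group cover_group by (rule cover_comm_group)
  obtain a where a: "a \<in> cover_carrier" "A = solenoid_proj a" using assms by (auto simp: carrier_solenoid)
  show "A \<noteq> {}" using solenoid_proj_self[OF a(1)] a by auto
  show sub: "A \<subseteq> cover_carrier"
    unfolding a(2) solenoid_proj_mem[OF a(1)] using G.m_closed[unfolded cover_group_simps(1)] a(1) diag_embed_closed by blast
  show eq: "A = solenoid_proj x" if "x \<in> A" for x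
    using that a G.repr_independence[of x "range diag_embed" a] diag_subgroup
    unfolding solenoid_proj_def by simp
  show "diag_embed q \<otimes>\<^bsub>cover_group\<^esub> x \<in> A" if "x \<in> A"
    using eq[OF that] solenoid_proj_mem[of x] sub that by blast
  show "\<exists>q. z = diag_embed q \<otimes>\<^bsub>cover_group\<^esub> x" if "x \<in> A" "z \<in> A"
    using eq[OF that(1)] solenoid_proj_mem[of x] sub that by blast
qed

lemma solenoid_dist_less_iff:
  assumes A: "A \<in> carrier solenoid" and B: "B \<in> carrier solenoid" and a: "a \<in> A"
  shows "solenoid_dist A B < c \<longleftrightarrow> (\<exists>b\<in>B. cover_dist a b < c)"
proof -
  interpret G: comm_group cover_group by (rule cover_comm_group)
  let ?S = "{cover_dist x z | x z. x \<in> A \<and> z \<in> B}"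
  obtain b where b: "b \<in> B" using solenoid_cosets(1)[OF B] by blast
  have ne: "?S \<noteq> {}" using a b by blast
  have bdd: "bdd_below ?S" by (rule bdd_belowI[of _ 0]) (auto simp: cover_dist_nonneg)
  have "solenoid_dist A B = Inf ?S" using A B by (simp only: solenoid_dist_def simp_thms if_True)
  then have "solenoid_dist A B < c \<longleftrightarrow> (\<exists>d\<in>?S. d < c)" using cInf_less_iff[OF ne bdd, of c] by simp
  also have "\<dots> \<longleftrightarrow> (\<exists>x\<in>A. \<exists>z\<in>B. cover_dist x z < c)" by blast
  also have "\<dots> \<longleftrightarrow> (\<exists>b\<in>B. cover_dist a b < c)"
  proof
    assume "\<exists>x\<in>A. \<exists>z\<in>B. cover_dist x z < c"
    then obtain x z where xz: "x \<in> A" "z \<in> B" "cover_dist x z < c" by blast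
    obtain q where q: "a = diag_embed q \<otimes>\<^bsub>cover_group\<^esub> x" using solenoid_cosets(5)[OF A xz(1) a] by blast
    have "cover_dist a (diag_embed q \<otimes>\<^bsub>cover_group\<^esub> z) = cover_dist x z"
      unfolding q using xz solenoid_cosets(2)[OF A] solenoid_cosets(2)[OF B]
      by (intro cover_dist_translate diag_embed_closed) auto
    then show "\<exists>b\<in>B. cover_dist a b < c" using solenoid_cosets(4)[OF B xz(2), of q] xz(3) by metis
  qed (use a in blast)
  finally show ?thesis .
qed

lemma solenoid_Metric_space: "Metric_space (carrier solenoid) solenoid_dist"
proof
  interpret C: Metric_space cover_carrier cover_dist by (rule cover_Metric_space)
  show nonneg: "0 \<le> solenoid_dist A B" for A B
  proof (cases "A \<in> carrier solenoid \<and> B \<in> carrier solenoid")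
    case True
    obtain a b where "a \<in> A" "b \<in> B" using solenoid_cosets(1) True by (meson ex_in_conv)
    then have "{cover_dist x z | x z. x \<in> A \<and> z \<in> B} \<noteq> {}" by blast
    then have "0 \<le> Inf {cover_dist x z | x z. x \<in> A \<and> z \<in> B}"
      by (rule cInf_greatest) (use cover_dist_nonneg in blast)
    then show ?thesis using True by (simp only: solenoid_dist_def simp_thms if_True)
  qed (simp only: solenoid_dist_def if_False order_refl)
  show "solenoid_dist A B = solenoid_dist B A" for A B
  proof -
    have "{cover_dist x z | x z. x \<in> A \<and> z \<in> B} = {cover_dist x z | x z. x \<in> B \<and> z \<in> A}"
      (is "?S = ?T")
    proof
      show "?S \<subseteq> ?T" by clarify (rule exI, rule exI, rule conjI, rule C.commute, simp)
      show "?T \<subseteq> ?S" by clarify (rule exI, rule exI, rule conjI, rule C.commute, simp)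
    qed
    then show ?thesis unfolding solenoid_dist_def by (simp only: conj_commute)
  qed
  show "solenoid_dist A B = 0 \<longleftrightarrow> A = B" if A: "A \<in> carrier solenoid" and B: "B \<in> carrier solenoid" for A B
  proof
    assume "A = B"
    obtain a where a: "a \<in> A" using solenoid_cosets(1)[OF A] by blast
    have "cover_dist a a = 0" using a solenoid_cosets(2)[OF A] by auto
    then have "solenoid_dist A B < c" if "c > 0" for c
      unfolding solenoid_dist_less_iff[OF A B a] using that a \<open>A = B\<close> by (intro bexI[of _ a]) simp_all
    from this[of "solenoid_dist A B"] show "solenoid_dist A B = 0" using nonneg[of A B] by linarith
  next
    assume d0: "solenoid_dist A B = 0"
    obtain a where a: "a \<in> A" using solenoid_cosets(1)[OF A] by blast
    have ac: "a \<in> cover_carrier" using a solenoid_cosets(2)[OF A] by blast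
    have close: "\<exists>b\<in>B. cover_dist a b < c" if "c > 0" for c
      using solenoid_dist_less_iff[OF A B a, of c] d0 that by simp
    obtain b where b: "b \<in> B" "cover_dist a b < 1/4" using close[of "1/4"] by auto
    have bc: "b \<in> cover_carrier" using b solenoid_cosets(2)[OF B] by blast
    have "cover_dist a b < c" if c: "c > 0" for c
    proof -
      obtain z where z: "z \<in> B" "cover_dist a z < min c (1/4)" using close[of "min c (1/4)"] c by auto
      have zc: "z \<in> cover_carrier" using z solenoid_cosets(2)[OF B] by blast
      obtain q where q: "z = diag_embed q \<otimes>\<^bsub>cover_group\<^esub> b" using solenoid_cosets(5)[OF B b(1) z(1)] by blast
      have zb: "cover_dist z b < 1/2"
        using C.triangle[OF zc ac bc] C.commute[of z a] b z by linarith
      have "q = 0"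
      proof (rule rat_eq_0_if_small)
        have "fst z - fst b = of_rat q" by (simp add: q diag_embed_def)
        then have "\<bar>of_rat q :: real\<bar> \<le> cover_dist z b" using cover_dist_ge(1)[OF zc bc] by (simp only:)
        then show "\<bar>of_rat q :: real\<bar> < 1" using zb by linarith
        fix p :: nat assume p: "prime p"
        interpret cring "Qp p" by (rule Qp_cring[OF p])
        have "(padic_of_rat p q \<oplus>\<^bsub>Qp p\<^esub> snd b p) \<ominus>\<^bsub>Qp p\<^esub> snd b p = padic_of_rat p q"
          using cover_coord[OF bc p] padic_of_rat_closed[OF p, of q] by algebra
        then have "snd z p \<ominus>\<^bsub>Qp p\<^esub> snd b p = padic_of_rat p q" using p by (simp add: q diag_embed_def)
        then have "rat_pabs p q \<le> real p * cover_dist z b"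
          using cover_dist_ge(2)[OF zc bc p] by (simp only: padic_abs_of_rat[OF p])
        also have "\<dots> < real p * 1"
          using zb prime_gt_0_nat[OF p] by (intro mult_strict_left_mono) auto
        finally show "rat_pabs p q < real p" by simp
      qed
      then have "z = b"
        using q diag_embed_0 monoid.l_one[OF group.is_monoid[OF comm_group.axioms(2)[OF cover_comm_group]], of b] bc
        by (simp del: cover_group_simps(2,3))
      then show ?thesis using z by simp
    qed
    from this[of "cover_dist a b"] have "cover_dist a b = 0" using cover_dist_nonneg[of a b] by linarith
    then have "a = b" using ac bc by simp
    then show "A = B" using solenoid_cosets(3)[OF A a] solenoid_cosets(3)[OF B b(1)] by simp
  qed
  show "solenoid_dist A C \<le> solenoid_dist A B + solenoid_dist B C"
    if A: "A \<in> carrier solenoid" and B: "B \<in> carrier solenoid" and C: "C \<in> carrier solenoid" for A B C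
  proof (rule field_le_epsilon)
    fix e :: real assume e: "e > 0"
    obtain a where a: "a \<in> A" using solenoid_cosets(1)[OF A] by blast
    obtain b where b: "b \<in> B" "cover_dist a b < solenoid_dist A B + e / 2"
      using solenoid_dist_less_iff[OF A B a, of "solenoid_dist A B + e / 2"] e by auto
    obtain c where c: "c \<in> C" "cover_dist b c < solenoid_dist B C + e / 2"
      using solenoid_dist_less_iff[OF B C b(1), of "solenoid_dist B C + e / 2"] e by auto
    have "cover_dist a c \<le> cover_dist a b + cover_dist b c"
      using a b c solenoid_cosets(2)[OF A] solenoid_cosets(2)[OF B] solenoid_cosets(2)[OF C]
      by (intro C.triangle) auto
    then have "cover_dist a c < solenoid_dist A B + solenoid_dist B C + e" using b c by linarith
    then have "solenoid_dist A C < solenoid_dist A B + solenoid_dist B C + e"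
      using solenoid_dist_less_iff[OF A C a] c by blast
    then show "solenoid_dist A C \<le> solenoid_dist A B + solenoid_dist B C + e" by simp
  qed
qed

declare cover_group_simps(2,3) [simp del]

lemma cover_cball_mem:
  "z \<in> cover_cball x r \<longleftrightarrow> x \<in> cover_carrier \<and> z \<in> cover_carrier \<and> cover_dist x z \<le> r"
  by (simp add: Metric_space.in_mcball[OF cover_Metric_space])

lemma cover_cball_radius_unique:
  assumes x: "x \<in> cover_carrier" and "r > 0" "s > 0" and eq: "cover_cball x r = cover_cball z s"
  shows "r = s"
proof -
  have sh: "(fst x + t, snd x) \<in> cover_carrier" if "x \<in> cover_carrier" for x t
    using that by (simp add: cover_carrier_def)
  have d: "cover_dist x (fst x + t, snd x) \<le> r" if x: "x \<in> cover_carrier" and t: "\<bar>t\<bar> = r" for x t r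
  proof -
    have "padic_abs p (snd x p \<ominus>\<^bsub>Qp p\<^esub> snd x p) = 0" if p: "prime p" for p
    proof -
      interpret cring "Qp p" by (rule Qp_cring[OF p])
      show ?thesis using padic_abs_zero_iff[OF p] cover_coord[OF x p] r_neg by (simp add: minus_eq)
    qed
    then show ?thesis unfolding cover_dist_le_iff[OF x sh[OF x]] using t by auto
  qed
  have *: "r \<le> s" if x: "x \<in> cover_carrier" and r: "r > 0" and sub: "cover_cball x r \<subseteq> cover_cball z s" for x z r s
  proof -
    have m: "(fst x + r, snd x) \<in> cover_cball z s" "(fst x + (- r), snd x) \<in> cover_cball z s"
      using d[OF x, of r r] d[OF x, of "- r" r] r x sh[OF x, of r] sh[OF x, of "- r"]
      by (auto intro!: subsetD[OF sub] simp: cover_cball_mem[of _ x])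
    then have z: "z \<in> cover_carrier" by (simp add: cover_cball_mem)
    have "\<bar>fst z - (fst x + r)\<bar> \<le> s" "\<bar>fst z - (fst x + (- r))\<bar> \<le> s"
      using m cover_dist_ge(1)[OF z sh[OF x, of r]] cover_dist_ge(1)[OF z sh[OF x, of "- r"]]
      by (simp_all add: cover_cball_mem)
    then show ?thesis by linarith
  qed
  have "x \<in> cover_cball x r"
    using d[OF x, of 0 0] x \<open>r > 0\<close> by (simp add: cover_cball_mem)
  then have z: "z \<in> cover_carrier" using eq by (simp add: cover_cball_mem)
  show ?thesis using *[OF x \<open>r > 0\<close>, of z s] *[OF z \<open>s > 0\<close>, of x r] eq by simp
qed

end

theory Submission
  imports Defs
begin

text \<open>
  Fix \<open>s > 0\<close> and suppose that the \<open>s\<close>-dimensional Hausdorff measure of \<open>F\<close> vanishes. Then \<open>F\<close> has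
  covers by sets \<open>U\<^sub>m\<close> of arbitrarily small total weight, where the weight of \<open>U\<^sub>m\<close> exceeds
  \<open>diam(U\<^sub>m)\<^sup>s\<close>. Let \<open>\<beta> = 1/K\<^sup>2\<close> with \<open>K\<close> large. Inside a ball of radius
  \<open>r\<close>, each \<open>p\<close>-adic coordinate with \<open>p \<le> K\<close> offers \<open>K\<close> positions that are more than \<open>\<beta>r\<close> apart,
  and Alice's cylinder affects only one coordinate; so with \<open>n + 1\<close> primes Bob has at least \<open>K\<^sup>n\<close>
  legal balls of radius \<open>\<beta>r\<close>, pairwise more than \<open>\<beta>r\<close> apart, and \<open>K\<^sup>n \<ge> \<beta>\<^bsup>-s\<^esup>\<close> once \<open>n \<ge> 2s\<close>. If the
  sets meeting the current ball have total weight below \<open>(\<beta>r)\<^sup>s\<close>, each of them has diameter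
  below \<open>\<beta>r\<close> and meets at most one of these balls, so by pigeonhole Bob finds one for which the
  bound holds again with \<open>\<beta>r\<close> in place of \<open>r\<close>. The weight of any \<open>U\<^sub>m\<close> that contains the outcome of
  the game is then \<open>0\<close>, which is absurd. Hence the outcome is not in \<open>F\<close>, although Alice plays to win.
\<close>

section \<open>The p-adic absolute value on the rationals\<close>

lemma rat_pabs_power: "prime p \<Longrightarrow> rat_pabs p (q ^ m) = rat_pabs p q ^ m"
  by (induction m) (simp_all add: rat_pabs_mult)

lemma rat_pabs_inverse:
  assumes p: "prime p"
  shows "rat_pabs p (inverse q) = inverse (rat_pabs p q)"
proof (cases "q = 0")
  case False
  then have "rat_pabs p q * rat_pabs p (inverse q) = 1"
    using rat_pabs_mult[OF p, of q "inverse q"] p by simp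
  then show ?thesis by (simp add: inverse_unique)
qed simp

lemma rat_pabs_power_int: "prime p \<Longrightarrow> rat_pabs p (q powi k) = rat_pabs p q powi k"
  by (cases k rule: int_cases3) (simp_all add: rat_pabs_power rat_pabs_inverse power_int_minus)

lemma rat_pabs_prime:
  assumes p: "prime p"
  shows "rat_pabs p (of_nat p) = inverse (real p)"
proof -
  have "multiplicity (int p) (int p) = 1"
    using p by (intro multiplicity_prime) (simp add: prime_int_nat_transfer)
  then show ?thesis
    using rat_pabs_frac[OF p, of "int p" 1] prime_gt_0_nat[OF p] by (simp add: power_int_minus)
qed

text \<open>The power of \<open>p\<close> dividing \<open>d\<close> is at most |d|. The bound is
  uniform in \<open>p\<close>, so distinct integers in [0, K) are at least 1/K apart at every prime,
  even at primes below \<open>K\<close>.\<close>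

lemma rat_pabs_of_int_ge:
  assumes p: "prime p" and d: "d \<noteq> 0"
  shows "1 / real_of_int \<bar>d\<bar> \<le> rat_pabs p (of_int d)"
proof -
  define m where "m = multiplicity (int p) d"
  have "int p ^ m \<le> \<bar>d\<bar>"
    using d multiplicity_dvd[of "int p" d] by (intro zdvd_imp_le) (auto simp: m_def)
  then have "real p ^ m \<le> real_of_int \<bar>d\<bar>"
    by (metis of_int_le_iff of_int_of_nat_eq of_int_power)
  moreover have "real p ^ m > 0" using prime_gt_0_nat[OF p] by simp
  moreover have "rat_pabs p (of_int d) = 1 / real p ^ m"
    using rat_pabs_frac[OF p d, of 1] by (simp add: m_def power_int_minus field_simps)
  ultimately show ?thesis by (simp add: frac_le)
qed

text \<open>The nonzero values are the powers of \<open>p\<close>, one of which lies in this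
  half-open interval. Such a \<open>q\<close> is the unit in which Bob displaces a
  coordinate.\<close>

lemma ex_rat_pabs_between:
  assumes p: "prime p" and r: "r > 0"
  obtains q where "r < rat_pabs p q" "rat_pabs p q \<le> real p * r"
proof -
  have p1: "real p > 1" using prime_gt_1_nat[OF p] by simp
  \<comment> \<open>\<open>k\<close> is the largest exponent with p^k <= r, and p^-(k+1) has
    absolute value p^(k+1).\<close>
  define k where "k = \<lfloor>log p r\<rfloor>"
  have "real p powr of_int k \<le> r" "r < real p powr (of_int k + 1)"
    using p1 r by (auto simp: k_def powr_le_iff less_powr_iff)
  then have k: "real p powi k \<le> r" "r < real p * real p powi k"
    using p1 by (simp_all add: powr_real_of_int' powr_add mult.commute)
  have "rat_pabs p (of_nat p powi (- (k + 1))) = real p * real p powi k"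
    unfolding rat_pabs_power_int[OF p] rat_pabs_prime[OF p] power_int_inverse
    using p1 by (simp only: power_int_minus inverse_inverse_eq) (simp add: power_int_add_1)
  then show ?thesis using k p1 by (intro that[of "of_nat p powi (- (k + 1))"]) auto
qed

section \<open>Differences in \<open>Qp\<close> and the ultrametric inequality\<close>

lemma padic_abs_triangle:
  assumes p: "prime p" and "x \<in> carrier (Qp p)" "y \<in> carrier (Qp p)" "z \<in> carrier (Qp p)"
  shows "padic_abs p (x \<ominus>\<^bsub>Qp p\<^esub> z) \<le> max (padic_abs p (x \<ominus>\<^bsub>Qp p\<^esub> y)) (padic_abs p (y \<ominus>\<^bsub>Qp p\<^esub> z))"
proof -
  interpret cring "Qp p" by (rule Qp_cring[OF p])
  have "x \<ominus>\<^bsub>Qp p\<^esub> z = (x \<ominus>\<^bsub>Qp p\<^esub> y) \<oplus>\<^bsub>Qp p\<^esub> (y \<ominus>\<^bsub>Qp p\<^esub> z)" using assms by algebra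
  then show ?thesis using padic_abs_add[OF p, of "x \<ominus>\<^bsub>Qp p\<^esub> y" "y \<ominus>\<^bsub>Qp p\<^esub> z"] assms by simp
qed

lemma padic_abs_diff_self:
  assumes p: "prime p" and x: "x \<in> carrier (Qp p)"
  shows "padic_abs p (x \<ominus>\<^bsub>Qp p\<^esub> x) = 0"
proof -
  interpret cring "Qp p" by (rule Qp_cring[OF p])
  show ?thesis using padic_abs_zero_iff[OF p] x r_neg[OF x] by (simp add: minus_eq)
qed

lemma padic_abs_shift_diff:
  assumes p: "prime p" and x: "x \<in> carrier (Qp p)"
  shows "padic_abs p ((x \<oplus>\<^bsub>Qp p\<^esub> padic_of_rat p a) \<ominus>\<^bsub>Qp p\<^esub> (x \<oplus>\<^bsub>Qp p\<^esub> padic_of_rat p b))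
       = rat_pabs p (a - b)"
proof -
  interpret cring "Qp p" by (rule Qp_cring[OF p])
  have c: "padic_of_rat p (a - b) \<in> carrier (Qp p)" "padic_of_rat p b \<in> carrier (Qp p)"
    using p by (simp_all add: padic_of_rat_closed)
  have "padic_of_rat p a = padic_of_rat p (a - b) \<oplus>\<^bsub>Qp p\<^esub> padic_of_rat p b"
    using padic_of_rat_add[OF p, of "a - b" b] by simp
  then have "(x \<oplus>\<^bsub>Qp p\<^esub> padic_of_rat p a) \<ominus>\<^bsub>Qp p\<^esub> (x \<oplus>\<^bsub>Qp p\<^esub> padic_of_rat p b) = padic_of_rat p (a - b)"
    using x c by (simp only:) algebra
  then show ?thesis by (simp add: padic_abs_of_rat[OF p])
qed

lemma padic_abs_shift:
  assumes p: "prime p" and x: "x \<in> carrier (Qp p)"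
  shows "padic_abs p ((x \<oplus>\<^bsub>Qp p\<^esub> padic_of_rat p a) \<ominus>\<^bsub>Qp p\<^esub> x) = rat_pabs p a"
proof -
  interpret cring "Qp p" by (rule Qp_cring[OF p])
  show ?thesis using padic_abs_shift_diff[OF p x, of a 0] x by (simp add: padic_of_rat_0[OF p])
qed

section \<open>Balls of the cover and Bob's legal moves\<close>

lemma ball_set_iff:
  assumes "x \<in> cover_carrier"
  shows "z \<in> ball_set (x, r) \<longleftrightarrow> z \<in> cover_carrier \<and> \<bar>fst x - fst z\<bar> \<le> r \<and>
           (\<forall>p. prime p \<longrightarrow> padic_abs p (snd x p \<ominus>\<^bsub>Qp p\<^esub> snd z p) \<le> real p * r)"
  using assms cover_dist_le_iff[OF assms, of z r] by (auto simp: ball_set_def cover_cball_mem)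

lemma cover_upd_real: "x \<in> cover_carrier \<Longrightarrow> (t, snd x) \<in> cover_carrier"
  by (simp add: cover_carrier_def)

lemma cover_change:
  assumes x: "x \<in> cover_carrier" and P: "finite P"
    and y: "\<And>p. prime p \<Longrightarrow> p \<in> P \<Longrightarrow> f p \<in> carrier (Qp p)"
  shows "(t, \<lambda>p\<in>primes. if p \<in> P then f p else snd x p) \<in> cover_carrier"
proof -
  let ?f = "\<lambda>p. if p \<in> P then f p else snd x p"
  have "finite {p\<in>primes. snd x p \<notin> Zp p}" using x by (simp add: cover_carrier_def)
  then have "finite {p\<in>primes. ?f p \<notin> Zp p}"
    by (rule finite_subset[rotated, OF finite_UnI[OF _ P]]) auto
  moreover have "{p\<in>primes. (\<lambda>p\<in>primes. ?f p) p \<notin> Zp p} = {p\<in>primes. ?f p \<notin> Zp p}" by auto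
  ultimately show ?thesis
    using y cover_coord[OF x] by (auto simp: cover_carrier_def restrict_PiE_iff)
qed

text \<open>Both real end points of the smaller ball are tested. Only the real coordinate gives such
  a bound: p-adically, centres of nested balls may be as far apart as the larger radius.\<close>

lemma ball_real_shrink:
  assumes x: "x \<in> cover_carrier" and x': "x' \<in> cover_carrier" and r': "r' \<ge> 0"
    and sub: "ball_set (x', r') \<subseteq> ball_set (x, r)"
  shows "\<bar>fst x - fst x'\<bar> + r' \<le> r"
proof -
  have "(t, snd x') \<in> ball_set (x', r')" if "\<bar>fst x' - t\<bar> = r'" for t
    using that r' cover_upd_real[OF x'] padic_abs_diff_self cover_coord[OF x']
    by (simp add: ball_set_iff[OF x'])
  from this[of "fst x' + r'"] this[of "fst x' - r'"]
  have "(fst x' + r', snd x') \<in> ball_set (x, r)" "(fst x' - r', snd x') \<in> ball_set (x, r)"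
    using sub r' by auto
  then have "\<bar>fst x - (fst x' + r')\<bar> \<le> r" "\<bar>fst x - (fst x' - r')\<bar> \<le> r"
    by (auto simp: ball_set_iff[OF x])
  then show ?thesis by linarith
qed

text \<open>A cylinder constrains a single coordinate, so Bob may start from the centre of any legal move
  and move the other \<open>p\<close>-adic coordinates around freely inside the current ball. Taking the
  constrained coordinate from a legal move also covers the case that the cylinder is as large as
  the ball in that coordinate, which Alice can arrange for large primes.\<close>

lemma bob_legal_change:
  assumes legal: "bob_legal \<beta> (x, r) (c, \<epsilon>, i) (x', r')"
    and x: "x \<in> cover_carrier" and r: "r > 0" and \<beta>: "0 < \<beta>" "\<beta> \<le> 1"
    and C: "is_cylinder (c, \<epsilon>, i)"
    and y: "y \<in> cover_carrier" "fst y = fst x'" "i \<noteq> 0 \<Longrightarrow> snd y i = snd x' i"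
    and yp: "\<And>p. prime p \<Longrightarrow> padic_abs p (snd y p \<ominus>\<^bsub>Qp p\<^esub> snd x' p) \<le> real p * r"
  shows "bob_legal \<beta> (x, r) (c, \<epsilon>, i) (y, \<beta> * r)"
proof -
  have x': "x' \<in> cover_carrier" and r': "r' > 0" "\<beta> * r \<le> r'"
    and sub: "ball_set (x', r') \<subseteq> ball_set (x, r) - cylinder c \<epsilon> i"
    using legal by (auto simp: bob_legal_def is_ball_def cyl_set_def)
  have shr: "\<bar>fst x - fst x'\<bar> + r' \<le> r"
    using ball_real_shrink[OF x x' less_imp_le[OF r'(1)]] sub by blast
  have self: "padic_abs p (snd w p \<ominus>\<^bsub>Qp p\<^esub> snd w p) \<le> real p * r'" if "prime p" "w \<in> cover_carrier" for p w
    using padic_abs_diff_self[OF that(1) cover_coord[OF that(2,1)]] r' by simp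
  have "x' \<in> ball_set (x', r')" using x' r' self by (simp add: ball_set_iff)
  then have x'x: "padic_abs p (snd x p \<ominus>\<^bsub>Qp p\<^esub> snd x' p) \<le> real p * r" if "prime p" for p
    using sub that by (auto simp: ball_set_iff[OF x])
  have "z \<in> ball_set (x, r) \<and> z \<notin> cylinder c \<epsilon> i" if z: "z \<in> ball_set (y, \<beta> * r)" for z
  proof
    have zc: "z \<in> cover_carrier" and z0: "\<bar>fst x' - fst z\<bar> \<le> \<beta> * r"
      and zp: "\<And>p. prime p \<Longrightarrow> padic_abs p (snd y p \<ominus>\<^bsub>Qp p\<^esub> snd z p) \<le> real p * (\<beta> * r)"
      using z y by (auto simp: ball_set_iff)
    have br: "\<beta> * r \<le> r" using \<beta> r by simp
    show "z \<in> ball_set (x, r)"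
      unfolding ball_set_iff[OF x]
    proof (intro conjI allI impI zc)
      show "\<bar>fst x - fst z\<bar> \<le> r" using shr z0 r' by linarith
      fix p :: nat assume p: "prime p"
      note k = cover_coord[OF x p] cover_coord[OF x' p] cover_coord[OF y(1) p] cover_coord[OF zc p]
      \<comment> \<open>The steps from \<open>x\<close> to \<open>x'\<close>, \<open>y\<close> and
        \<open>z\<close> are each at most p r and do not add up, by the ultrametric
        inequality.\<close>
      have "real p * (\<beta> * r) \<le> real p * r" using br by (intro mult_left_mono) auto
      then show "padic_abs p (snd x p \<ominus>\<^bsub>Qp p\<^esub> snd z p) \<le> real p * r"
        using padic_abs_triangle[OF p k(1,2,4)] padic_abs_triangle[OF p k(2,3,4)]
          Qp_minus_commute[OF p k(2,3)] yp[OF p] zp[OF p] x'x[OF p] by linarith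
    qed
    show "z \<notin> cylinder c \<epsilon> i"
    proof
      assume zC: "z \<in> cylinder c \<epsilon> i"
      \<comment> \<open>\<open>z'\<close> takes coordinate \<open>i\<close> from \<open>z\<close>
        and all others from \<open>x'\<close>. It stays in the cylinder, which sees coordinate
        \<open>i\<close> only, and it lies in the ball around \<open>x'\<close>, since
        \<open>y\<close> and \<open>x'\<close> agree at \<open>i\<close>.\<close>
      define z' where "z' = (if i = 0 then (fst z, snd x')
        else (fst x', \<lambda>p\<in>primes. if p \<in> {i} then snd z p else snd x' p))"
      have "z' \<in> cover_carrier"
        using cover_upd_real[OF x'] cover_change[OF x', of "{i}" "snd z"] cover_coord[OF zc]
        by (auto simp: z'_def)
      moreover have "z' \<in> cylinder c \<epsilon> i"
        using zC C calculation by (auto simp: cylinder_def z'_def is_cylinder_def)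
      moreover have "z' \<in> ball_set (x', r')"
        unfolding ball_set_iff[OF x']
      proof (intro conjI allI impI)
        show "\<bar>fst x' - fst z'\<bar> \<le> r'" using z0 r' by (auto simp: z'_def)
        fix p :: nat assume p: "prime p"
        show "padic_abs p (snd x' p \<ominus>\<^bsub>Qp p\<^esub> snd z' p) \<le> real p * r'"
        proof (cases "p = i")
          case True
          have i: "i \<noteq> 0" using p True by auto
          have "padic_abs p (snd x' p \<ominus>\<^bsub>Qp p\<^esub> snd z' p) \<le> real p * (\<beta> * r)"
            using zp[OF p] True y(3)[OF i] p i by (simp add: z'_def)
          also have "\<dots> \<le> real p * r'" using r' by (intro mult_left_mono) auto
          finally show ?thesis .
        qed (use self[OF p x'] p in \<open>auto simp: z'_def\<close>)
      qed fact
      ultimately show False using sub by blast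
    qed
  qed
  then show ?thesis
    using y r \<beta> by (auto simp: bob_legal_def is_ball_def cyl_set_def)
qed

text \<open>The centres arise from that of a legal move by shifts j * q with 0 <= j < K and r < |q|
  <= p r, at each prime \<open>p\<close> of \<open>P\<close> that Alice leaves free. Distinct
  centres differ by more than r / K at some \<open>p\<close>, whereas the new balls and the required
  gap only amount to p \<open>\<beta>\<close> r <= r / K there.\<close>

lemma bob_children:
  assumes \<beta>: "\<beta> = 1 / (real K)\<^sup>2" and K: "K \<ge> 1"
    and P: "finite P" "\<And>p. p \<in> P \<Longrightarrow> prime p \<and> p \<le> K" "card P > n"
    and x: "x \<in> cover_carrier" and r: "r > 0"
    and C: "is_cylinder C" and ex: "\<exists>B. bob_legal \<beta> (x, r) C B"
  obtains Y where "finite Y" "card Y \<ge> K ^ n"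
    and "\<And>y. y \<in> Y \<Longrightarrow> bob_legal \<beta> (x, r) C (y, \<beta> * r)"
    and "\<And>y y' z z'. y \<in> Y \<Longrightarrow> y' \<in> Y \<Longrightarrow> y \<noteq> y' \<Longrightarrow> z \<in> ball_set (y, \<beta> * r) \<Longrightarrow>
           z' \<in> ball_set (y', \<beta> * r) \<Longrightarrow> cover_dist z z' > \<beta> * r"
proof -
  obtain c \<epsilon> i where Ci: "C = (c, \<epsilon>, i)" by (metis prod_cases3)
  obtain x' r' where leg: "bob_legal \<beta> (x, r) (c, \<epsilon>, i) (x', r')"
    using ex Ci by (metis surj_pair)
  have x': "x' \<in> cover_carrier" using leg by (auto simp: bob_legal_def is_ball_def)
  have \<beta>01: "0 < \<beta>" "\<beta> \<le> 1" using K by (auto simp: \<beta> divide_le_eq)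
  \<comment> \<open>Alice constrains at most one prime, so more than \<open>n\<close> primes leave
    at least \<open>n\<close>.\<close>
  define Q where "Q = P - {i}"
  have Q: "finite Q" "\<And>p. p \<in> Q \<Longrightarrow> prime p \<and> p \<le> K" "card Q \<ge> n"
    using P by (auto simp: Q_def card_Diff_singleton_if)
  have "\<exists>q. r < rat_pabs p q \<and> rat_pabs p q \<le> real p * r" if "prime p" for p
    using ex_rat_pabs_between[OF that r] by metis
  then obtain q where q: "\<And>p. prime p \<Longrightarrow> r < rat_pabs p (q p)" "\<And>p. prime p \<Longrightarrow> rat_pabs p (q p) \<le> real p * r"
    by metis
  define J where "J = (\<Pi>\<^sub>E p\<in>Q. {..<K})"
  define g where "g j = (fst x', \<lambda>p\<in>primes. if p \<in> Q
      then snd x' p \<oplus>\<^bsub>Qp p\<^esub> padic_of_rat p (of_nat (j p) * q p) else snd x' p)" for j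
  have g: "g j \<in> cover_carrier" for j
    unfolding g_def
    by (rule cover_change[OF x' Q(1)])
       (auto intro!: cring.cring_simprules(1)[OF Qp_cring] padic_of_rat_closed cover_coord[OF x'])
  have gd: "padic_abs p (snd (g j) p \<ominus>\<^bsub>Qp p\<^esub> snd (g k) p) = rat_pabs p (of_int (int (j p) - int (k p))) * rat_pabs p (q p)"
    if "p \<in> Q" for p j k
    using padic_abs_shift_diff[OF _ cover_coord[OF x'], of p "of_nat (j p) * q p" "of_nat (k p) * q p"] Q(2)[OF that] that
    by (simp add: g_def rat_pabs_mult[symmetric] algebra_simps)
  have sep: "cover_dist z z' > \<beta> * r"
    if jk: "j \<in> J" "k \<in> J" "j \<noteq> k" and z: "z \<in> ball_set (g j, \<beta> * r)" "z' \<in> ball_set (g k, \<beta> * r)" for j k z z'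
  proof (rule ccontr)
    assume "\<not> ?thesis"
    then have d: "cover_dist z z' \<le> \<beta> * r" by simp
    obtain p where p: "p \<in> Q" "j p \<noteq> k p"
      using jk PiE_ext unfolding J_def by metis
    have pp: "prime p" "p \<le> K" using Q(2)[OF p(1)] by auto
    have zc: "z \<in> cover_carrier" "z' \<in> cover_carrier" using z by (auto simp: ball_set_iff[OF g])
    note m = cover_coord[OF g pp(1), of j] cover_coord[OF g pp(1), of k] cover_coord[OF zc(1) pp(1)] cover_coord[OF zc(2) pp(1)]
    have "padic_abs p (snd (g j) p \<ominus>\<^bsub>Qp p\<^esub> snd z p) \<le> real p * (\<beta> * r)"
      "padic_abs p (snd (g k) p \<ominus>\<^bsub>Qp p\<^esub> snd z' p) \<le> real p * (\<beta> * r)"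
      "padic_abs p (snd z p \<ominus>\<^bsub>Qp p\<^esub> snd z' p) \<le> real p * (\<beta> * r)"
      using z d pp cover_dist_le_iff[OF zc] by (auto simp: ball_set_iff[OF g])
    \<comment> \<open>The maximum of the three bounds suffices, so no factor 3 is lost.\<close>
    then have "padic_abs p (snd (g j) p \<ominus>\<^bsub>Qp p\<^esub> snd (g k) p) \<le> real p * (\<beta> * r)"
      using padic_abs_triangle[OF pp(1) m(1,3,2)] padic_abs_triangle[OF pp(1) m(3,4,2)]
        Qp_minus_commute[OF pp(1) m(2,4)] by linarith
    also have "\<dots> \<le> real K * (\<beta> * r)" using pp \<beta>01 r by (intro mult_right_mono) auto
    also have "\<dots> = 1 / real K * r" using K by (simp add: \<beta> power2_eq_square)
    finally have le: "rat_pabs p (of_int (int (j p) - int (k p))) * rat_pabs p (q p) \<le> 1 / real K * r"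
      using gd[OF p(1), of j k] by simp
    have "j p < K" "k p < K" using jk p(1) by (auto simp: J_def)
    then have "\<bar>int (j p) - int (k p)\<bar> \<le> int K" "\<bar>int (j p) - int (k p)\<bar> > 0" using p(2) by auto
    then have "1 / real K \<le> 1 / real_of_int \<bar>int (j p) - int (k p)\<bar>"
      by (intro divide_left_mono) (auto simp del: of_int_abs of_int_diff)
    also have "\<dots> \<le> rat_pabs p (of_int (int (j p) - int (k p)))"
      using p(2) by (intro rat_pabs_of_int_ge[OF pp(1)]) auto
    finally have "1 / real K * rat_pabs p (q p) \<le> 1 / real K * r"
      using le mult_right_mono[OF _ rat_pabs_nonneg[of p "q p"]] by (meson order_trans)
    then have "rat_pabs p (q p) \<le> r" using K by (simp add: divide_right_mono field_simps)
    then show False using q(1)[OF pp(1)] by simp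
  qed
  have self: "g j \<in> ball_set (g j, \<beta> * r)" for j
    using g \<beta>01 r padic_abs_diff_self cover_coord[OF g] by (simp add: ball_set_iff[OF g])
  have "inj_on g J"
  proof (rule inj_onI, rule ccontr)
    fix j k assume jk: "j \<in> J" "k \<in> J" "g j = g k" "j \<noteq> k"
    have "cover_dist (g j) (g k) > \<beta> * r" using sep[OF jk(1,2,4) self self] .
    moreover have "cover_dist (g j) (g j) = 0"
      using Metric_space.zero[OF cover_Metric_space g[of j] g[of j]] by simp
    moreover have "\<beta> * r > 0" using \<beta>01 r by simp
    ultimately show False using jk(3) by simp
  qed
  moreover have "card J = K ^ card Q" "finite J"
    using Q(1) by (auto simp: J_def card_PiE intro!: finite_PiE)
  ultimately have card: "card (g ` J) \<ge> K ^ n" "finite (g ` J)"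
    using Q(3) K by (auto simp: card_image intro!: power_increasing)
  show ?thesis
  proof (rule that[OF card(2,1)])
    fix y assume "y \<in> g ` J"
    then obtain j where j: "y = g j" by blast
    show "bob_legal \<beta> (x, r) C (y, \<beta> * r)"
      unfolding Ci j
    proof (rule bob_legal_change[OF leg x r \<beta>01 C[unfolded Ci] g])
      show "fst (g j) = fst x'" by (simp add: g_def)
      show "snd (g j) i = snd x' i" if "i \<noteq> 0"
        using C that by (simp add: g_def Q_def Ci is_cylinder_def)
      fix p :: nat assume p: "prime p"
      \<comment> \<open>Integers have absolute value at most 1, so all \<open>K\<close> multiples of
        \<open>q p\<close> respect the bound p r.\<close>
      have "rat_pabs p (of_nat (j p)) \<le> 1"
      proof (rule ccontr)
        assume "\<not> ?thesis"
        then show False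
          using rat_pabs_gt_1D[OF p, of "of_nat (j p)" "int (j p)" 1] p by (auto simp: prime_nat_iff)
      qed
      then have "rat_pabs p (of_nat (j p) * q p) \<le> 1 * (real p * r)"
        unfolding rat_pabs_mult[OF p] using q(2)[OF p] by (intro mult_mono) auto
      then show "padic_abs p (snd (g j) p \<ominus>\<^bsub>Qp p\<^esub> snd x' p) \<le> real p * r"
        using p r padic_abs_diff_self[OF p cover_coord[OF x' p]] padic_abs_shift[OF p cover_coord[OF x' p]]
        by (simp add: g_def)
    qed
  qed (use sep in blast)
qed

section \<open>Local comparison of the cover and the solenoid\<close>

text \<open>Translation changes every coordinate by the same \<open>q\<close>. Because of the factor
  1/p in the metric, |q| < 1 and |q|_p < p for all p, so \<open>q\<close> is an integer of size
  below 1.\<close>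

lemma diag_embed_translate_small:
  assumes z: "z \<in> cover_carrier" and d: "cover_dist (diag_embed q \<otimes>\<^bsub>cover_group\<^esub> z) z < 1"
  shows "q = 0"
proof (rule rat_eq_0_if_small)
  have qz: "diag_embed q \<otimes>\<^bsub>cover_group\<^esub> z \<in> cover_carrier"
    using cover_add_closed[OF diag_embed_closed z] by (simp add: cover_group_simps(2))
  have "fst (diag_embed q \<otimes>\<^bsub>cover_group\<^esub> z) - fst z = of_rat q"
    by (simp add: cover_group_simps(2) diag_embed_def)
  then show "\<bar>of_rat q :: real\<bar> < 1" using cover_dist_ge(1)[OF qz z] d by (simp only:)
  fix p :: nat assume p: "prime p"
  interpret cring "Qp p" by (rule Qp_cring[OF p])
  note c = cover_coord[OF z p] padic_of_rat_closed[OF p, of q]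
  have "snd (diag_embed q \<otimes>\<^bsub>cover_group\<^esub> z) p = snd z p \<oplus>\<^bsub>Qp p\<^esub> padic_of_rat p q"
    using p c by (simp add: cover_group_simps(2) diag_embed_def a_comm)
  then have "rat_pabs p q \<le> real p * cover_dist (diag_embed q \<otimes>\<^bsub>cover_group\<^esub> z) z"
    using cover_dist_ge(2)[OF qz z p] padic_abs_shift[OF p c(1), of q] by simp
  also have "\<dots> < real p * 1"
    using d prime_gt_0_nat[OF p] by (intro mult_strict_left_mono) auto
  finally show "rat_pabs p q < real p" by simp
qed

text \<open>A strictly closer point of the fibre over \<open>z\<close> would be a translate of
  \<open>z\<close> at distance below 1 from it, hence \<open>z\<close> itself. So projecting does
  not shrink distances up to 1/2.\<close>

lemma cover_dist_le_solenoid_dist: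
  assumes x: "x \<in> cover_carrier" and z: "z \<in> cover_carrier" and d: "cover_dist x z \<le> 1 / 2"
  shows "cover_dist x z \<le> solenoid_dist (solenoid_proj x) (solenoid_proj z)"
proof (rule ccontr)
  interpret C: Metric_space cover_carrier cover_dist by (rule cover_Metric_space)
  assume "\<not> ?thesis"
  moreover have "solenoid_proj x \<in> carrier solenoid" "solenoid_proj z \<in> carrier solenoid"
    using x z by (auto simp: carrier_solenoid)
  ultimately obtain b where b: "b \<in> solenoid_proj z" "cover_dist x b < cover_dist x z"
    using solenoid_dist_less_iff[OF _ _ solenoid_proj_self[OF x]] by (meson not_le)
  obtain q where q: "b = diag_embed q \<otimes>\<^bsub>cover_group\<^esub> z"
    using b(1) solenoid_proj_mem[OF z] by auto
  have bc: "b \<in> cover_carrier"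
    unfolding q using cover_add_closed[OF diag_embed_closed z] by (simp add: cover_group_simps(2))
  have "cover_dist b z < 1"
    using C.triangle[OF bc x z] C.commute[of b x] b(2) d by linarith
  then have "q = 0" using diag_embed_translate_small[OF z] q by simp
  then have "b = z"
    using q z diag_embed_0 monoid.l_one[OF group.is_monoid[OF comm_group.axioms(2)[OF cover_comm_group]], of z]
    by simp
  then show False using b(2) by simp
qed

section \<open>Covers of small weight and the pigeonhole principle\<close>

text \<open>The bound by \<open>\<delta>\<close> excludes an infinite diameter, which
  \<open>enn2real\<close> would turn into 0.\<close>

lemma dist_le_enn2real_ediam:
  assumes "x \<in> U" "y \<in> U" "ediam d U \<le> ennreal \<delta>"
  shows "d x y \<le> enn2real (ediam d U)"
proof -
  have "ediam d U < \<infinity>" using assms(3) le_less_trans[of "ediam d U" "ennreal \<delta>"] by simp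
  moreover have "ennreal (d x y) \<le> ediam d U"
    unfolding ediam_def by (rule SUP_upper2[OF assms(1)], rule SUP_upper[OF assms(2)])
  ultimately show ?thesis
    using ennreal_le_iff[OF enn2real_nonneg, of "d x y" "ediam d U"] by simp
qed

lemma hausdorff_measure_zero_cover:
  assumes "hausdorff_measure M d s E = 0" and \<eta>: "\<eta> > 0"
  obtains U :: "nat \<Rightarrow> _" where "E \<subseteq> (\<Union>n. U n)" "\<And>n. ediam d (U n) \<le> ennreal 1"
    "(\<Sum>n. ennreal (enn2real (ediam d (U n)) powr s)) < \<eta>"
proof -
  \<comment> \<open>The measure is a supremum over scales, so the premeasure at scale 1 vanishes
    too.\<close>
  have "hausdorff_premeasure M d s 1 E \<le> hausdorff_measure M d s E"
    unfolding hausdorff_measure_def by (rule SUP_upper) simp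
  then have "hausdorff_premeasure M d s 1 E < \<eta>" using assms by simp
  then show ?thesis unfolding hausdorff_premeasure_def INF_less_iff using that by blast
qed

text \<open>Averaging: if every \<open>y\<close> had a total of at least \<open>c\<close>,
  exchanging the sums would make the total of \<open>w\<close> at least card Y times c.\<close>

lemma ex_small_sum:
  fixes h :: "'a \<Rightarrow> nat \<Rightarrow> ennreal"
  assumes Y: "finite Y" "Y \<noteq> {}" and h: "\<And>n. (\<Sum>y\<in>Y. h y n) \<le> w n" and w: "(\<Sum>n. w n) < of_nat (card Y) * c"
  shows "\<exists>y\<in>Y. (\<Sum>n. h y n) < c"
proof (rule ccontr)
  assume "\<not> ?thesis"
  then have "(\<Sum>y\<in>Y. c) \<le> (\<Sum>y\<in>Y. \<Sum>n. h y n)" by (intro sum_mono) auto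
  also have "\<dots> = (\<Sum>n. \<Sum>y\<in>Y. h y n)" by (rule suminf_sum[symmetric]) simp
  also have "\<dots> \<le> (\<Sum>n. w n)" by (intro suminf_le h) auto
  finally show False using w by simp
qed

section \<open>Bob's play against a winning strategy\<close>

lemma hausdorff_measure_CAW_pos:
  assumes F: "solenoid_CAW F" and s: "s > 0"
  shows "hausdorff_measure (carrier solenoid) solenoid_dist s F \<noteq> 0"
proof
  assume H0: "hausdorff_measure (carrier solenoid) solenoid_dist s F = 0"
  interpret C: Metric_space cover_carrier cover_dist by (rule cover_Metric_space)
  obtain \<beta>1 where \<beta>1: "0 < \<beta>1" "\<beta>1 \<le> 1/3"
    "\<And>\<beta>. 0 < \<beta> \<Longrightarrow> \<beta> < \<beta>1 \<Longrightarrow> cylinder_absolute_winning_at \<beta> {x \<in> cover_carrier. solenoid_proj x \<in> F}"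
    using F by (auto simp: solenoid_CAW_def CAW_def)
  \<comment> \<open>K^n is then at least K^(2s) = \<open>\<beta> powr (- s)\<close>.\<close>
  define n where "n = nat \<lceil>2 * s\<rceil>"
  have n: "2 * s \<le> real n" by (simp add: n_def of_nat_ceiling)
  obtain P where P: "P \<subseteq> primes" "finite P" "card P = Suc n"
    using infinite_arbitrarily_large[OF primes_infinite, of "Suc n"] by auto
  \<comment> \<open>\<open>K\<close> bounds the primes in \<open>P\<close> and exceeds 1 /
    \<open>\<beta>1\<close>, which puts 1 / K^2 below \<open>\<beta>1\<close>.\<close>
  define K where "K = Max (insert (nat \<lceil>1 / \<beta>1\<rceil> + 2) P)"
  have KP: "p \<le> K" if "p \<in> P" for p using P that by (simp add: K_def)
  have K\<beta>: "nat \<lceil>1 / \<beta>1\<rceil> + 2 \<le> K" using P by (simp add: K_def)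
  then have K2: "K \<ge> 2" and K1: "K \<ge> 1" by simp_all
  define \<beta> where "\<beta> = 1 / (real K)\<^sup>2"
  have \<beta>0: "\<beta> > 0" using K1 by (simp add: \<beta>_def)
  have "1 / \<beta>1 < real K" using K\<beta> by linarith
  then have "1 / \<beta>1 < real K * real K"
    using K1 by (smt (verit) mult_left_mono mult_cancel_left1 of_nat_1 of_nat_le_iff mult_right_mono)
  then have \<beta>lt: "\<beta> < \<beta>1" using \<beta>1(1) K1 by (simp add: \<beta>_def power2_eq_square field_simps)
  then have \<beta>l: "\<beta> < 1" using \<beta>1(2) by simp
  obtain S where S: "winning_strategy \<beta> {x \<in> cover_carrier. solenoid_proj x \<in> F} S"
    using \<beta>1(3)[OF \<beta>0 \<beta>lt] by (auto simp: cylinder_absolute_winning_at_def)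
  have S1: "alice_legal \<beta> (last Bs) (S Bs)" "\<exists>B. bob_legal \<beta> (last Bs) (S Bs) B" if "play \<beta> S Bs" for Bs
    using S that by (auto simp: winning_strategy_def)
  have Ks: "\<beta> powr (- s) \<le> real (K ^ n)"
  proof -
    have "\<beta> powr (- s) = real K powr (2 * s)"
      using K1 by (simp add: \<beta>_def powr_minus powr_divide powr_powr inverse_eq_divide flip: powr_numeral)
    also have "\<dots> \<le> real K powr real n" using n K1 by (intro powr_mono) auto
    finally show ?thesis using K1 by (simp add: powr_realpow)
  qed
  \<comment> \<open>Radius of Bob's ball at stage \<open>k\<close>. Starting at 1/4 keeps any two
    points of a ball within 1/2, where projecting does not shrink distances.\<close>
  define \<rho> where "\<rho> k = \<beta> ^ k / 4" for k
  have \<rho>0: "\<rho> k > 0" for k using \<beta>0 by (simp add: \<rho>_def)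
  have \<rho>S: "\<rho> (Suc k) = \<beta> * \<rho> k" for k by (simp add: \<rho>_def)
  have \<rho>le: "\<rho> k \<le> 1 / 4" for k using \<beta>0 \<beta>l by (simp add: \<rho>_def power_le_one)
  \<comment> \<open>Half of the initial budget: one half pays for the diameters, the other for the
    terms that make the weights positive.\<close>
  define \<eta> where "\<eta> = \<rho> 1 powr s / 2"
  have \<eta>: "\<eta> > 0" using \<rho>0[of 1] by (simp add: \<eta>_def)
  obtain U where U: "F \<subseteq> (\<Union>m. U m)" "\<And>m. ediam solenoid_dist (U m) \<le> ennreal 1"
    "(\<Sum>m. ennreal (enn2real (ediam solenoid_dist (U m)) powr s)) < ennreal \<eta>"
  proof (rule hausdorff_measure_zero_cover[OF H0])
    show "ennreal \<eta> > 0" using \<eta> by simp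
  qed blast
  define D where "D m = enn2real (ediam solenoid_dist (U m))" for m
  \<comment> \<open>The second summand keeps the weight of sets of diameter \<open>0\<close> positive.\<close>
  define w where "w m = D m powr s + \<eta> * (1/2) ^ Suc m" for m
  have w0: "w m > 0" for m using \<eta> by (simp add: w_def add_nonneg_pos)
  have wsum: "(\<Sum>m. ennreal (w m)) < ennreal (\<rho> 1 powr s)"
  proof -
    have "(\<lambda>m. \<eta> * (1/2) ^ Suc m) sums (\<eta> * 1)" by (intro sums_mult power_half_series)
    then have "(\<Sum>m. ennreal (\<eta> * (1/2) ^ Suc m)) = ennreal \<eta>"
      using \<eta> by (subst suminf_ennreal_eq) auto
    moreover have "(\<Sum>m. ennreal (w m)) = (\<Sum>m. ennreal (D m powr s)) + (\<Sum>m. ennreal (\<eta> * (1/2) ^ Suc m))"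
      using \<eta> by (subst suminf_add) (auto simp: w_def intro!: suminf_cong ennreal_plus)
    ultimately have "(\<Sum>m. ennreal (w m)) < ennreal \<eta> + ennreal \<eta>"
      using U(3) by (simp add: D_def ennreal_add_left_cancel_less add.commute)
    then show ?thesis using \<eta> by (simp add: \<eta>_def flip: ennreal_plus)
  qed
  define h where "h B m = (if \<exists>x\<in>ball_set B. solenoid_proj x \<in> U m then ennreal (w m) else 0)"
    for B m
  \<comment> \<open>Stage \<open>k\<close> has k + 1 balls, as counting starts at 0. The budget uses
    the next radius, because sets meeting the current ball must be too small to reach two of its
    successors.\<close>
  define good where "good k Bs \<longleftrightarrow> play \<beta> S Bs \<and> length Bs = Suc k \<and> snd (last Bs) = \<rho> k \<and>
     (\<Sum>m. h (last Bs) m) < ennreal (\<rho> (Suc k) powr s)" for k Bs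
  have hw: "ennreal (w m) < ennreal (\<rho> (Suc k) powr s)"
    if "good k Bs" "x \<in> ball_set (last Bs)" "solenoid_proj x \<in> U m" for k Bs x m
  proof -
    have "ennreal (w m) = h (last Bs) m" using that by (auto simp: h_def)
    also have "\<dots> \<le> (\<Sum>m. h (last Bs) m)" using sum_le_suminf[of "h (last Bs)" "{m}"] by simp
    finally show ?thesis using that(1) by (simp add: good_def le_less_trans)
  qed
  have play_ball: "is_ball (last Bs)" if "play \<beta> S Bs" for Bs
    using that by cases (auto simp: bob_legal_def)
  have step: "\<exists>B. good (Suc k) (Bs @ [B])" if good: "good k Bs" for k Bs
  proof -
    have pl: "play \<beta> S Bs" using good by (simp add: good_def)
    obtain x where x: "last Bs = (x, \<rho> k)" using good by (metis good_def prod.collapse)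
    have xc: "x \<in> cover_carrier" using play_ball[OF pl] x by (simp add: is_ball_def)
    obtain Y where Y: "finite Y" "card Y \<ge> K ^ n"
      "\<And>y. y \<in> Y \<Longrightarrow> bob_legal \<beta> (x, \<rho> k) (S Bs) (y, \<beta> * \<rho> k)"
      "\<And>y y' z z'. y \<in> Y \<Longrightarrow> y' \<in> Y \<Longrightarrow> y \<noteq> y' \<Longrightarrow> z \<in> ball_set (y, \<beta> * \<rho> k) \<Longrightarrow>
           z' \<in> ball_set (y', \<beta> * \<rho> k) \<Longrightarrow> cover_dist z z' > \<beta> * \<rho> k"
    proof (rule bob_children[OF \<beta>_def K1 P(2) _ _ xc \<rho>0[of k]])
      show "\<And>p. p \<in> P \<Longrightarrow> prime p \<and> p \<le> K" using P(1) KP by auto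
      show "n < card P" using P(3) by simp
      show "is_cylinder (S Bs)" using S1(1)[OF pl] by (simp add: alice_legal_def)
      show "\<exists>B. bob_legal \<beta> (x, \<rho> k) (S Bs) B" using S1(2)[OF pl] x by simp
    qed blast
    let ?w = "\<lambda>m. h (last Bs) m"
    have sub: "ball_set (y, \<rho> (Suc k)) \<subseteq> ball_set (last Bs)" if "y \<in> Y" for y
      using Y(3)[OF that] x by (auto simp: bob_legal_def \<rho>S)
    \<comment> \<open>A set reaching two successors has diameter above
      \<open>\<rho> (Suc k)\<close>, so its weight alone exhausts the budget of the current
      ball.\<close>
    have uniq: "y = y'"
      if y: "y \<in> Y" "z \<in> ball_set (y, \<rho> (Suc k))" "solenoid_proj z \<in> U m"
        and y': "y' \<in> Y" "z' \<in> ball_set (y', \<rho> (Suc k))" "solenoid_proj z' \<in> U m" for y y' z z' m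
    proof (rule ccontr)
      assume "y \<noteq> y'"
      then have far: "cover_dist z z' > \<rho> (Suc k)" using Y(4) y y' by (simp add: \<rho>S)
      have zb: "z \<in> ball_set (last Bs)" "z' \<in> ball_set (last Bs)"
        using sub[OF y(1)] sub[OF y'(1)] y(2) y'(2) by blast+
      then have zc: "z \<in> cover_carrier" "z' \<in> cover_carrier" and "cover_dist x z \<le> \<rho> k" "cover_dist x z' \<le> \<rho> k"
        by (auto simp: x ball_set_def cover_cball_mem)
      then have "cover_dist z z' \<le> 1 / 2"
        using C.triangle[OF zc(1) xc zc(2)] C.commute[of z x] \<rho>le[of k] by linarith
      then have "cover_dist z z' \<le> solenoid_dist (solenoid_proj z) (solenoid_proj z')"
        by (rule cover_dist_le_solenoid_dist[OF zc])
      also have "\<dots> \<le> D m" unfolding D_def using y(3) y'(3) U(2) by (rule dist_le_enn2real_ediam)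
      finally have "\<rho> (Suc k) powr s \<le> D m powr s"
        using far \<rho>0[of "Suc k"] s by (intro powr_mono2) auto
      also have "\<dots> \<le> w m" using \<eta> by (simp add: w_def)
      finally have "ennreal (\<rho> (Suc k) powr s) \<le> ennreal (w m)" by (rule ennreal_leI)
      then show False using hw[OF good zb(1) y(3)] by simp
    qed
    have "\<exists>y\<in>Y. (\<Sum>m. h (y, \<rho> (Suc k)) m) < ennreal (\<rho> (Suc (Suc k)) powr s)"
    proof (rule ex_small_sum[where w = ?w])
      have "K ^ n > 0" using K1 by simp
      then show "Y \<noteq> {}" using Y(2) by auto
      show "(\<Sum>y\<in>Y. h (y, \<rho> (Suc k)) m) \<le> ?w m" for m
      proof (cases "\<exists>y\<in>Y. \<exists>z\<in>ball_set (y, \<rho> (Suc k)). solenoid_proj z \<in> U m")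
        case True
        then obtain y z where y: "y \<in> Y" "z \<in> ball_set (y, \<rho> (Suc k))" "solenoid_proj z \<in> U m" by blast
        have "h (y', \<rho> (Suc k)) m = 0" if "y' \<in> Y - {y}" for y'
          unfolding h_def using uniq[OF y, of y'] that by (intro if_not_P) blast
        then have "(\<Sum>y\<in>Y. h (y, \<rho> (Suc k)) m) = (\<Sum>y\<in>{y}. h (y, \<rho> (Suc k)) m)"
          using y(1) Y(1) by (intro sum.mono_neutral_right) blast+
        also have "\<dots> \<le> ennreal (w m)" by (simp add: h_def)
        also have "\<dots> = ?w m" using y(2,3) sub[OF y(1)] by (auto simp: h_def)
        finally show ?thesis .
      next
        case False
        then have "h (y, \<rho> (Suc k)) m = 0" if "y \<in> Y" for y
          unfolding h_def using that by (intro if_not_P) blast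
        then show ?thesis by simp
      qed
      \<comment> \<open>At least \<open>\<beta> powr (- s)\<close> successors share the current
        budget, so one of them gets less than the budget of the next stage.\<close>
      have "\<rho> (Suc k) powr s = \<beta> powr (- s) * \<rho> (Suc (Suc k)) powr s"
        using \<rho>0 \<beta>0 by (simp add: \<rho>S[of "Suc k"] powr_mult powr_minus less_imp_le less_imp_neq[THEN not_sym])
      also have "\<dots> \<le> real (K ^ n) * \<rho> (Suc (Suc k)) powr s" using Ks by (intro mult_right_mono) auto
      also have "\<dots> \<le> real (card Y) * \<rho> (Suc (Suc k)) powr s" using Y(2) by (intro mult_right_mono of_nat_mono) auto
      finally have "ennreal (\<rho> (Suc k) powr s) \<le> of_nat (card Y) * ennreal (\<rho> (Suc (Suc k)) powr s)"
        by (simp add: ennreal_of_nat_eq_real_of_nat flip: ennreal_mult')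
      then show "(\<Sum>m. ?w m) < of_nat (card Y) * ennreal (\<rho> (Suc (Suc k)) powr s)"
        using good unfolding good_def by (meson less_le_trans)
    qed (rule Y(1))
    then obtain y where y: "y \<in> Y" "(\<Sum>m. h (y, \<rho> (Suc k)) m) < ennreal (\<rho> (Suc (Suc k)) powr s)" by blast
    have "bob_legal \<beta> (last Bs) (S Bs) (y, \<rho> (Suc k))" using Y(3)[OF y(1)] x by (simp add: \<rho>S)
    then have "play \<beta> S (Bs @ [(y, \<rho> (Suc k))])" by (rule play.extend[OF pl])
    then have "good (Suc k) (Bs @ [(y, \<rho> (Suc k))])" using y good by (simp add: good_def)
    then show ?thesis by blast
  qed
  have start: "\<exists>Bs. good 0 Bs"
  proof -
    let ?B = "((0, \<lambda>p\<in>primes. \<zero>\<^bsub>Qp p\<^esub>), \<rho> 0)"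
    have "(\<Sum>m. h ?B m) \<le> (\<Sum>m. ennreal (w m))" by (intro suminf_le) (auto simp: h_def)
    moreover have "is_ball ?B" using cover_zero_closed \<rho>0 by (simp add: is_ball_def)
    ultimately have "good 0 [?B]" using wsum by (auto simp: good_def intro: play.start)
    then show ?thesis by blast
  qed
  \<comment> \<open>Each play extends the previous one, so all are initial segments of a single
    infinite play.\<close>
  obtain f where f: "\<And>k. good k (f k)" "\<And>k. \<exists>B. f (Suc k) = f k @ [B]"
    using dependent_nat_choice[of good "\<lambda>k Bs Bs'. \<exists>B. Bs' = Bs @ [B]"] start step by metis
  define B where "B k = last (f k)" for k
  have "f k = map B [0..<Suc k]" for k
  proof (induction k)
    case 0
    have "length (f 0) = 1" using f(1)[of 0] by (simp add: good_def)
    then show ?case by (auto simp: B_def length_Suc_conv)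
  next
    case (Suc k)
    then show ?case using f(2)[of k] by (auto simp: B_def)
  qed
  then have "play \<beta> S (map B [0..<Suc k])" for k using f(1)[of k] by (simp add: good_def)
  then obtain x where x: "x \<in> (\<Inter>k. ball_set (B k))" "solenoid_proj x \<in> F"
    using S[unfolded winning_strategy_def, THEN conjunct2, rule_format, of B] by blast
  obtain m where m: "solenoid_proj x \<in> U m" using x(2) U(1) by blast
  \<comment> \<open>The outcome lies in every ball, so a set containing it is charged at every
    stage.\<close>
  have "w m < \<rho> (Suc k) powr s" for k
    using hw[OF f(1)[of k] _ m] x(1) w0[of m] by (auto simp: B_def ennreal_less_iff)
  moreover have "(\<lambda>k. \<rho> (Suc k) powr s) \<longlonglongrightarrow> 0"
  proof -
    have "(\<lambda>k. \<beta> ^ k) \<longlonglongrightarrow> 0" using \<beta>0 \<beta>l by (intro LIMSEQ_power_zero) simp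
    then have "(\<lambda>k. \<rho> k) \<longlonglongrightarrow> 0" unfolding \<rho>_def by (rule tendsto_divide_zero)
    then have "(\<lambda>k. \<rho> k powr s) \<longlonglongrightarrow> 0 powr s"
      using s \<rho>0 by (intro tendsto_powr2 tendsto_const) (auto intro!: always_eventually simp: less_imp_le)
    then show ?thesis using LIMSEQ_Suc by fastforce
  qed
  ultimately have "w m \<le> 0" by (meson LIMSEQ_le_const less_imp_le)
  then show False using w0[of m] by simp
qed

theorem corollary5p7:
  fixes F :: "cover_point set set"
  assumes "solenoid_CAW F"
  shows "hausdorff_dim (carrier solenoid) solenoid_dist F = \<infinity>"
proof -
  have "{ennreal s | s. s > 0 \<and> hausdorff_measure (carrier solenoid) solenoid_dist s F = 0} = {}"
    using hausdorff_measure_CAW_pos[OF assms] by blast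
  then show ?thesis by (simp only: hausdorff_dim_def Inf_empty infinity_ennreal_def)
qed

end
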